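(* Let $c\in \mathbb{C}$ and $\alpha\in \mathfrak h[[h]]$. The action of the generators $\hat y_j^{(r)}$ of $\mathrm{H}(C)$ on $$\mathcal V_{\mathrm{H}}(c,\alpha)\equiv\mathbb C [\,\hat x_{jj}^{(-r)} : j=1, \ldots ,N-1,\ r=1,2,\ldots\,][[h]]$$ is of the form $$\hat y_j^{(-r)} =\hat x_{jj}^{(-r)}\mod h,\qquad \hat y_j^{(r)} =rc\,\frac{\partial}{\partial \hat x_{jj}^{(-r)}}\mod h,\qquad \hat y_j^{(0)} = \langle\hat a_j,\alpha\rangle$$ for all $j=1, \ldots ,N-1$ and $r=1,2,\ldots$.
   Context: **Conventions.** $N\geqslant 2$ is an integer, $h$ a formal parameter. A $\mathbb C[[h]]$-module is topologically free if it is torsion-free, separated and $h$-adically complete (equivalently $\cong V_0[[h]]$). $\mathrm{Hom}$ means $\mathbb C[[h]]$-module maps. For a $\mathbb C[[h]]$-module $V$, $V((u))_h$ is the module of series $\sum_{r\in\mathbb Z}a_ru^{-r-1}\in V[[u^{\pm1}]]$ with $a_r\to0$ $h$-adically as $r\to\infty$, and $V[u^{-1}]_h$ the submodule of those in $V[[u^{-1}]]$. Expressions $(x_1+\dots+x_n)^r$ with $r<0$ are expanded in nonnegative powers of $x_2,\dots,x_n$. Subscripts indicate the tensor factors on which operators act. $\mathrm{diag}$ keeps only the terms whose matrix part is a tensor product of diagonal matrix units (in all matrix factors). **The series $S$.** Let $R(u)=I-\frac hu P$ on $\mathbb C^N\otimes\mathbb C^N$, $I$ the identity, $P=\sum_{i,j}e_{ij}\otimes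 e_{ji}$. There is a unique series $G(u,C)=1+\frac{C+N}{N}\frac{h^2}{u^2}-\dots\in\mathbb C[C][[h/u]]$ with $\mathrm{tr}_1(G(u,C)R(u)R(-u-hC)-I)=\mathrm{tr}_2(G(u,C)R(u)R(-u-hC)-I)=0$. Put $S(u,C)=h^{-2}(G(u,C)R(u)R(-u-hC)-I)$, $S(u)=S(u,c)$, and let $s_{ij}(u,C)$ be the coefficient of $e_{ii}\otimes e_{jj}$ in $S(u,C)$. **The algebra $\mathrm{H}(C)$** is the $h$-adically complete associative $\mathbb C[[h]]$-algebra generated by a central element $C$ and $y_i^{(r)}$, $i=1,\dots,N$, $r\in\mathbb Z$, subject to, with $y^i(u)=\sum_{r\in\mathbb Z}y_i^{(r)}u^{-r-1}$, $y^i(u)y^j(v)+s_{ij}(u-v,C)=y^j(v)y^i(u)+s_{ij}(v-u,C)$ for all $i,j$ and $y^1(u)+\dots+y^N(u)=0$. Put $y(u)=\sum_ie_{ii}\otimes y^i(u)$. An $\mathrm{H}(C)$-module $W$ has level $c$ if $C$ acts as the scalar $c$; it is restricted if $W$ is topologically free and $y^i(z)\in\mathrm{Hom}(W,W((z))_h)$ for all $i$. **$\mathcal V_{\mathrm{H}}(c)$ and operators.** $\mathrm{H}^+_N$ is the quotient of $\mathbb C[x_{ij}^{(-r)}: i,j=1,\dots,N,\ r\geqslant1][[h]]$ by the $h$-adically complete ideal generated by $x_{11}^{(-r)}+\dots+x_{NN}^{(-r)}$, $r\geqslant1$; $\mathbf 1$ is its unit. Put $x^+_{ij}(u)=\sum_{r\geqslant1}x_{ij}^{(-r)}u^{r-1}$,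 $x^+(u)=\sum_{i,j}e_{ij}\otimes x^+_{ij}(u)$, $x^+_{[n]}(u)=x^+_1(u_1)\cdots x^+_n(u_n)$, $x^+_{[0]}=\mathbf 1$. $x^-(u)=\sum_{i,j}e_{ij}\otimes x^-_{ij}(u)$, $x^-_{ij}(u)=\sum_{r\geqslant1}x_{ij}^{(r-1)}u^{-r}$, is the unique element of $\mathrm{End}\,\mathbb C^N\otimes\mathrm{Hom}(\mathrm{H}^+_N,\mathrm{H}^+_N[u^{-1}]_h)$ with $x^-(u)\mathbf 1=0$ and $x^-_0(u_0)x^+_{[n]}(u)=-\sum_{j=1}^nS_{0j}(u_0-u_j)x_1^+(u_1)\cdots x_{j-1}^+(u_{j-1})x_{j+1}^+(u_{j+1})\cdots x_n^+(u_n)$ for all $n\geqslant1$. Put $x(u)=x^+(u)+x^-(u)$, with $x^+(u)$ acting by multiplication. $\mathcal V_{\mathrm{H}}(c)\subset\mathrm{H}^+_N$ is the topologically free subalgebra generated by $\mathbf 1$ and all $x_{ii}^{(-r)}$, $i=1,\dots,N$, $r\geqslant1$. **$\mathfrak h$ and the new generators.** $\mathfrak h$ is the complex space (abelian Lie algebra) with generators $a_1,\dots,a_N$ and relation $a_1+\dots+a_N=0$, with symmetric bilinear form $\langle a_i,a_j\rangle=\delta_{ij}-\frac1N$, extended $\mathbb C[[h]]$-bilinearly to $\mathfrak h[[h]]$. Let $\hat a_1,\dots,\hat a_{N-1}$ be an orthonormal basis of $\mathfrak h$ of the form $\hat a_j=\sum_{i=1}^j\nu_{ij}a_i$, $\nu_{ij}\in\mathbb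 C$. Put $\hat y_j^{(r)}=\sum_{i=1}^j\nu_{ij}y_i^{(r)}$ ($j=1,\dots,N-1$, $r\in\mathbb Z$) and $\hat x_{jj}^{(-r)}=\sum_{i=1}^j\nu_{ij}x_{ii}^{(-r)}$ ($j=1,\dots,N-1$, $r\geqslant1$); the latter are free (topological) polynomial generators of $\mathcal V_{\mathrm{H}}(c)$. **The module $\mathcal V_{\mathrm{H}}(c,\alpha)$** is $\mathcal V_{\mathrm{H}}(c)$ with the unique structure of restricted $\mathrm{H}(C)$-module of level $c$ such that for all $n\geqslant0$, $y_0(u_0)\,\mathrm{diag}(x^+_{[n]}(u))=\mathrm{diag}\big((x_0(u_0)+u_0^{-1}a_0(\alpha))x^+_{[n]}(u)\big)$, where $a(\alpha)=\sum_{i=1}^N\langle a_i,\alpha\rangle e_{ii}$ and the subscript $0$ refers to the first tensor factor of $\mathrm{End}\,\mathbb C^N\otimes(\mathrm{End}\,\mathbb C^N)^{\otimes n}\otimes\mathcal V_{\mathrm{H}}(c)$. In the claim, $\hat x_{jj}^{(-r)}$ denotes the multiplication operator, and equality mod $h$ means equality of operators on $\mathcal V_{\mathrm{H}}(c)$ modulo $h$. *)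

theory Defs
  imports
    "HOL-Analysis.Finite_Cartesian_Product"
    "HOL-Computational_Algebra.Formal_Power_Series"
    "HOL-Computational_Algebra.Polynomial"
    "HOL-Library.Poly_Mapping"
begin

text \<open>
  Throughout, \<^typ>\<open>complex fps\<close> is the ring of power series in \<open>h\<close> (so \<open>h\<close> is
  \<^const>\<open>fps_X\<close>), and the index set \<open>{1,\<dots>,N}\<close> is the finite linearly ordered type \<open>'n\<close>,
  with \<open>N = CARD('n)\<close>; the indices \<open>1,\<dots>,N-1\<close> are the non-maximal elements of \<open>'n\<close>.
\<close>

section \<open>Modules over the power series ring\<close>

definition hpow_sub :: "(complex fps \<Rightarrow> 'w \<Rightarrow> 'w) \<Rightarrow> 'w set \<Rightarrow> nat \<Rightarrow> 'w set" where
  "hpow_sub smul W n = smul (fps_X ^ n) ` W"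

definition h_null :: "(complex fps \<Rightarrow> 'w \<Rightarrow> 'w) \<Rightarrow> 'w set \<Rightarrow> (nat \<Rightarrow> 'w) \<Rightarrow> bool" where
  "h_null smul W f \<longleftrightarrow> (\<forall>n. \<exists>r0. \<forall>r\<ge>r0. f r \<in> hpow_sub smul W n)"

definition topologically_free ::
  "(complex fps \<Rightarrow> 'w::ab_group_add \<Rightarrow> 'w) \<Rightarrow> 'w set \<Rightarrow> bool" where
  "topologically_free smul W \<longleftrightarrow>
     module smul \<and> module.subspace smul W \<and>
     (\<forall>a. \<forall>w\<in>W. smul a w = 0 \<longrightarrow> a = 0 \<or> w = 0) \<and>
     (\<Inter>n. hpow_sub smul W n) = {0} \<and>
     (\<forall>f. (\<forall>k. f k \<in> W) \<and> (\<forall>n. \<exists>k0. \<forall>k\<ge>k0. \<forall>l\<ge>k0. f k - f l \<in> hpow_sub smul W n)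
        \<longrightarrow> (\<exists>w\<in>W. h_null smul W (\<lambda>k. f k - w)))"

definition equal_mod_h ::
  "(complex fps \<Rightarrow> 'w::ab_group_add \<Rightarrow> 'w) \<Rightarrow> 'w set \<Rightarrow> ('w \<Rightarrow> 'w) \<Rightarrow> ('w \<Rightarrow> 'w) \<Rightarrow> bool" where
  "equal_mod_h smul W A B \<longleftrightarrow> (\<forall>w\<in>W. A w - B w \<in> hpow_sub smul W 1)"

text \<open>The two-sided ideal generated by \<open>X\<close>, and its \<open>h\<close>-adic closure in a ring of power series.\<close>

inductive_set ideal_gen :: "'a::ring_1 set \<Rightarrow> 'a set" for X where
  ideal_gen_base: "x \<in> X \<Longrightarrow> a * x * b \<in> ideal_gen X"
| ideal_gen_zero: "0 \<in> ideal_gen X"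
| ideal_gen_add: "x \<in> ideal_gen X \<Longrightarrow> y \<in> ideal_gen X \<Longrightarrow> x + y \<in> ideal_gen X"

definition h_ideal :: "'a::ring_1 fps set \<Rightarrow> 'a fps set" where
  "h_ideal X = {f. \<forall>n. \<exists>g\<in>ideal_gen X. \<exists>k. f - g = fps_X ^ n * k}"

lemma ideal_gen_mult_left: "x \<in> ideal_gen X \<Longrightarrow> c * x \<in> ideal_gen X"
proof (induction rule: ideal_gen.induct)
  case (ideal_gen_base x a b)
  then have "(c * a) * x * b \<in> ideal_gen X" by (rule ideal_gen.intros)
  then show ?case by (simp add: mult.assoc)
qed (auto simp: distrib_left intro: ideal_gen.intros)

lemma ideal_gen_mult_right: "x \<in> ideal_gen X \<Longrightarrow> x * c \<in> ideal_gen X"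
proof (induction rule: ideal_gen.induct)
  case (ideal_gen_base x a b)
  then have "a * x * (b * c) \<in> ideal_gen X" by (rule ideal_gen.intros)
  then show ?case by (simp add: mult.assoc)
qed (auto simp: distrib_right intro: ideal_gen.intros)

lemma h_ideal_zero: "0 \<in> h_ideal X"
  unfolding h_ideal_def by (auto intro!: bexI[of _ 0] exI[of _ 0] ideal_gen_zero)

lemma h_ideal_add:
  assumes "f \<in> h_ideal X" "g \<in> h_ideal X"
  shows "f + g \<in> h_ideal X"
  unfolding h_ideal_def
proof (intro CollectI allI)
  fix n
  from assms obtain f' g' k l where
    *: "f' \<in> ideal_gen X" "f - f' = fps_X ^ n * k" "g' \<in> ideal_gen X" "g - g' = fps_X ^ n * l"
    unfolding h_ideal_def by blast
  have "(f + g) - (f' + g') = (f - f') + (g - g')" by simp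
  also have "\<dots> = fps_X ^ n * (k + l)" by (simp only: * distrib_left)
  finally show "\<exists>g'\<in>ideal_gen X. \<exists>k. f + g - g' = fps_X ^ n * k"
    using * by (intro bexI[of _ "f' + g'"] exI[of _ "k + l"] ideal_gen_add)
qed

lemma h_ideal_mult_left:
  assumes "f \<in> h_ideal X"
  shows "c * f \<in> h_ideal X"
  unfolding h_ideal_def
proof (intro CollectI allI)
  fix n
  from assms obtain f' k where *: "f' \<in> ideal_gen X" "f - f' = fps_X ^ n * k"
    unfolding h_ideal_def by blast
  have "c * f - c * f' = c * (f - f')" by (simp add: right_diff_distrib)
  also have "\<dots> = fps_X ^ n * (c * k)"
    unfolding *(2) mult.assoc[symmetric] fps_mult_fps_X_power_commute[symmetric] by simp
  finally show "\<exists>g'\<in>ideal_gen X. \<exists>k. c * f - g' = fps_X ^ n * k"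
    using * by (intro bexI[of _ "c * f'"] exI[of _ "c * k"] ideal_gen_mult_left)
qed

lemma h_ideal_mult_right:
  assumes "f \<in> h_ideal X"
  shows "f * c \<in> h_ideal X"
  unfolding h_ideal_def
proof (intro CollectI allI)
  fix n
  from assms obtain f' k where *: "f' \<in> ideal_gen X" "f - f' = fps_X ^ n * k"
    unfolding h_ideal_def by blast
  have "f * c - f' * c = (f - f') * c" by (simp add: left_diff_distrib)
  also have "\<dots> = fps_X ^ n * (k * c)" by (simp only: * mult.assoc)
  finally show "\<exists>g'\<in>ideal_gen X. \<exists>k. f * c - g' = fps_X ^ n * k"
    using * by (intro bexI[of _ "f' * c"] exI[of _ "k * c"] ideal_gen_mult_right)
qed

lemma h_ideal_minus: "f \<in> h_ideal X \<Longrightarrow> - f \<in> h_ideal X"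
  using h_ideal_mult_left[of f X "-1"] by simp

lemma h_ideal_equivp: "equivp (\<lambda>f g. f - g \<in> h_ideal X)"
proof (rule equivpI)
  show "reflp (\<lambda>f g. f - g \<in> h_ideal X)" by (simp add: reflp_def h_ideal_zero)
  show "symp (\<lambda>f g. f - g \<in> h_ideal X)"
    unfolding symp_def by (metis h_ideal_minus minus_diff_eq)
  show "transp (\<lambda>f g. f - g \<in> h_ideal X)"
    unfolding transp_def by (metis h_ideal_add diff_add_cancel add_diff_eq)
qed

lemma h_ideal_cong_add:
  "f - f' \<in> h_ideal X \<Longrightarrow> g - g' \<in> h_ideal X \<Longrightarrow> (f + g) - (f' + g') \<in> h_ideal X"
  using h_ideal_add[of "f - f'" X "g - g'"] by (simp add: algebra_simps)

lemma h_ideal_cong_minus: "f - f' \<in> h_ideal X \<Longrightarrow> - f - (- f') \<in> h_ideal X"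
  using h_ideal_minus[of "f - f'" X] by (simp add: algebra_simps)

lemma h_ideal_cong_diff:
  "f - f' \<in> h_ideal X \<Longrightarrow> g - g' \<in> h_ideal X \<Longrightarrow> (f - g) - (f' - g') \<in> h_ideal X"
  using h_ideal_add[of "f - f'" X "- (g - g')"] h_ideal_minus[of "g - g'" X]
  by (simp add: algebra_simps)

lemma h_ideal_cong_mult:
  "f - f' \<in> h_ideal X \<Longrightarrow> g - g' \<in> h_ideal X \<Longrightarrow> f * g - f' * g' \<in> h_ideal X"
  using h_ideal_add[OF h_ideal_mult_right[of "f - f'" X g] h_ideal_mult_left[of "g - g'" X f']]
  by (simp add: algebra_simps)

definition of_series :: "complex fps \<Rightarrow> ('m::zero \<Rightarrow>\<^sub>0 complex) fps" where
  "of_series a = Abs_fps (\<lambda>n. Poly_Mapping.single 0 (fps_nth a n))"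

lemma of_series_add: "of_series (a + b) = of_series a + of_series b"
  by (simp add: of_series_def fps_eq_iff single_add)

lemma of_series_one: "of_series 1 = 1"
  by (simp add: of_series_def fps_eq_iff)

lemma of_series_mult:
  "of_series (a * b) = (of_series a :: ('m::monoid_add \<Rightarrow>\<^sub>0 complex) fps) * of_series b"
proof -
  have single_sum: "Poly_Mapping.single (0::'m) (sum f A) = (\<Sum>x\<in>A. Poly_Mapping.single 0 (f x))"
    for f :: "nat \<Rightarrow> complex" and A
    by (induction A rule: infinite_finite_induct) (simp_all add: single_add)
  show ?thesis
    by (simp add: of_series_def fps_eq_iff fps_mult_nth single_sum mult_single)
qed


section \<open>The series \<open>S\<close>\<close>

text \<open>
  Elements of \<open>(End C\<^sup>N)\<^sup>\<otimes>\<^sup>2\<close> are matrices indexed by pairs: the coefficient of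
  \<open>e\<^sub>i\<^sub>j \<otimes> e\<^sub>k\<^sub>l\<close> is the entry in row \<open>(i, k)\<close> and column \<open>(j, l)\<close>.  The ring
  \<open>C[C][[h/u]]\<close> is \<^typ>\<open>complex poly fps\<close>: the polynomial variable is \<open>C\<close>, and
  \<^const>\<open>fps_X\<close> is \<open>h/u\<close>.
\<close>

type_synonym 'n mat2 = "((complex poly fps)^('n \<times> 'n))^('n \<times> 'n)"

definition P_mat :: "('n::finite) mat2" where
  "P_mat = (\<chi> a b. if fst a = snd b \<and> snd a = fst b then 1 else 0)"

text \<open>\<open>R_mat z\<close> is \<open>R(w)\<close> for \<open>h/w = z\<close>.\<close>

definition R_mat :: "complex poly fps \<Rightarrow> ('n::finite) mat2" where
  "R_mat z = mat 1 - mat z ** P_mat"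

text \<open>
  The expansion of \<open>h/(-u-hC)\<close> in nonnegative powers of \<open>hC\<close>, that is
  \<open>-\<Sum>\<^sub>n (-C)\<^sup>n (h/u)\<^sup>n\<^sup>+\<^sup>1\<close>.
\<close>

definition crossed_var :: "complex poly fps" where
  "crossed_var = - (fps_X * Abs_fps (\<lambda>n. (- [:0, 1:]) ^ n))"

definition ptrace1 :: "('n::finite) mat2 \<Rightarrow> ((complex poly fps)^'n)^'n" where
  "ptrace1 M = (\<chi> k l. \<Sum>i\<in>UNIV. M $ (i, k) $ (i, l))"

definition ptrace2 :: "('n::finite) mat2 \<Rightarrow> ((complex poly fps)^'n)^'n" where
  "ptrace2 M = (\<chi> i j. \<Sum>k\<in>UNIV. M $ (i, k) $ (j, k))"

definition G_series :: "('n::finite) itself \<Rightarrow> complex poly fps" where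
  "G_series _ = (THE G.
     ptrace1 (mat G ** R_mat fps_X ** R_mat crossed_var - mat 1 :: 'n mat2) = 0 \<and>
     ptrace2 (mat G ** R_mat fps_X ** R_mat crossed_var - mat 1 :: 'n mat2) = 0)"

definition GRR :: "('n::finite) mat2" where
  "GRR = mat (G_series TYPE('n)) ** R_mat fps_X ** R_mat crossed_var - mat 1"

lemma mat_mult_nth: "(mat z ** A) $ a $ b = z * A $ a $ b"
  for A :: "('a::comm_ring_1)^('m::finite)^'m"
  by (simp add: matrix_matrix_mult_def mat_def if_distrib[where f = "\<lambda>x. x * _"] cong: if_cong)

lemma P_mat_mult_nth: "(P_mat ** A) $ a $ b = A $ (snd a, fst a) $ b"
proof -
  have "(fst a = snd k \<and> snd a = fst k) = (k = (snd a, fst a))" for k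
    by auto
  then show ?thesis
    by (simp add: matrix_matrix_mult_def P_mat_def if_distrib[where f = "\<lambda>x. x * _"] cong: if_cong)
qed

lemma matrix_diff_rdistrib: "(A - B) ** D = A ** D - B ** D"
  for A B D :: "('a::comm_ring_1)^('m::finite)^'m"
  by (simp add: vec_eq_iff matrix_matrix_mult_def left_diff_distrib sum_subtractf)

lemma GRR_entry:
  "(mat G ** R_mat z ** R_mat w - mat 1 :: ('n::finite) mat2) $ a $ b =
     (if a = b then G * (1 + z * w) - 1 else 0) - (if a = prod.swap b then G * (z + w) else 0)"
proof -
  have "R_mat z ** R_mat w = R_mat w - mat z ** (P_mat ** (R_mat w :: 'n mat2))"
    unfolding R_mat_def[of z] by (simp add: matrix_diff_rdistrib matrix_mul_assoc)
  moreover have "mat G ** R_mat z ** R_mat w = mat G ** (R_mat z ** (R_mat w :: 'n mat2))"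
    by (simp add: matrix_mul_assoc)
  ultimately have
    "(mat G ** R_mat z ** R_mat w - mat 1 :: 'n mat2) $ a $ b =
       G * ((R_mat w :: 'n mat2) $ a $ b - z * (R_mat w :: 'n mat2) $ (snd a, fst a) $ b) -
       (mat 1 :: 'n mat2) $ a $ b"
    by (simp only: mat_mult_nth P_mat_mult_nth vector_minus_component)
  moreover have "(mat 1 :: 'n mat2) $ a $ b = (if a = b then 1 else 0)"
    by (simp add: mat_def)
  moreover have "(R_mat w :: 'n mat2) $ a $ b =
      (if a = b then 1 else 0) - w * (if a = prod.swap b then 1 else 0)"
    unfolding R_mat_def vector_minus_component mat_mult_nth
    by (simp add: mat_def P_mat_def prod_eq_iff conj_commute)
  moreover have "(R_mat w :: 'n mat2) $ (snd a, fst a) $ b =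
      (if a = prod.swap b then 1 else 0) - w * (if a = b then 1 else 0)"
    unfolding R_mat_def vector_minus_component mat_mult_nth
    by (simp add: mat_def P_mat_def prod_eq_iff conj_commute)
  ultimately show ?thesis
    by (cases "a = b"; cases "a = prod.swap b") (simp_all add: ring_distribs mult.left_commute)
qed

lemma G_series_condition:
  fixes G z w :: "complex poly fps"
  defines "M \<equiv> mat G ** R_mat z ** R_mat w - mat 1 :: ('n::finite) mat2"
  shows "ptrace1 M = 0 \<and> ptrace2 M = 0 \<longleftrightarrow>
    G * (of_nat CARD('n) * (1 + z * w) - (z + w)) = of_nat CARD('n)"
proof -
  have 1: "ptrace1 M $ k $ l =
      (if k = l then G * (of_nat CARD('n) * (1 + z * w) - (z + w)) - of_nat CARD('n) else 0)" for k l
  proof -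
    have "ptrace1 M $ k $ l = (\<Sum>i\<in>UNIV. (if k = l then G * (1 + z * w) - 1 else 0) -
        (if i = l then if k = l then G * (z + w) else 0 else 0))"
      unfolding ptrace1_def M_def vec_lambda_beta GRR_entry by (intro sum.cong) auto
    also have "\<dots> =
        (if k = l then G * (of_nat CARD('n) * (1 + z * w) - (z + w)) - of_nat CARD('n) else 0)"
      unfolding sum_subtractf by (simp add: algebra_simps)
    finally show ?thesis .
  qed
  have 2: "ptrace2 M $ k $ l =
      (if k = l then G * (of_nat CARD('n) * (1 + z * w) - (z + w)) - of_nat CARD('n) else 0)" for k l
  proof -
    have "ptrace2 M $ k $ l = (\<Sum>i\<in>UNIV. (if k = l then G * (1 + z * w) - 1 else 0) -
        (if i = l then if k = l then G * (z + w) else 0 else 0))"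
      unfolding ptrace2_def M_def vec_lambda_beta GRR_entry by (intro sum.cong) auto
    also have "\<dots> =
        (if k = l then G * (of_nat CARD('n) * (1 + z * w) - (z + w)) - of_nat CARD('n) else 0)"
      unfolding sum_subtractf by (simp add: algebra_simps)
    finally show ?thesis .
  qed
  show ?thesis
    by (auto simp: vec_eq_iff 1 2)
qed

lemma crossed_var_nth: "fps_nth crossed_var 0 = 0" "fps_nth crossed_var (Suc 0) = - 1"
  by (simp_all add: crossed_var_def fps_mult_nth_1')

lemma of_nat_fps_poly: "(of_nat n :: complex poly fps) = fps_const [:of_nat n:]"
  by (simp add: fps_of_nat[symmetric] of_nat_poly)

lemma ex1_G_series:
  "\<exists>!G. ptrace1 (mat G ** R_mat fps_X ** R_mat crossed_var - mat 1 :: ('n::finite) mat2) = 0 \<and>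
        ptrace2 (mat G ** R_mat fps_X ** R_mat crossed_var - mat 1 :: 'n mat2) = 0"
proof -
  define N :: "complex poly fps" where "N = of_nat CARD('n)"
  define D where "D = N * (1 + fps_X * crossed_var) - (fps_X + crossed_var)"
  have "fps_nth D 0 * [:1 / of_nat CARD('n):] = 1"
    by (simp add: D_def N_def crossed_var_nth of_nat_fps_poly)
  then have inv: "D * fps_right_inverse D [:1 / of_nat CARD('n):] = 1"
    by (rule fps_right_inverse)
  have cond: "ptrace1 (mat G ** R_mat fps_X ** R_mat crossed_var - mat 1 :: 'n mat2) = 0 \<and>
      ptrace2 (mat G ** R_mat fps_X ** R_mat crossed_var - mat 1 :: 'n mat2) = 0 \<longleftrightarrow> G * D = N" for G
    unfolding G_series_condition D_def N_def by (rule refl)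
  show ?thesis
    unfolding cond
  proof (rule ex1I)
    show "N * fps_right_inverse D [:1 / of_nat CARD('n):] * D = N"
      using inv by (simp add: mult.commute mult.left_commute)
    show "G = N * fps_right_inverse D [:1 / of_nat CARD('n):]" if "G * D = N" for G
    proof -
      have "G = G * (D * fps_right_inverse D [:1 / of_nat CARD('n):])"
        unfolding inv by simp
      then show ?thesis
        unfolding mult.assoc[symmetric] that .
    qed
  qed
qed

lemma GRR_nth_less_2:
  assumes "n < 2"
  shows "fps_nth ((GRR :: ('n::finite) mat2) $ a $ b) n = 0"
proof -
  define N :: "complex poly fps" where "N = of_nat CARD('n)"
  define G where "G = G_series TYPE('n)"
  have "G * (N * (1 + fps_X * crossed_var) - (fps_X + crossed_var)) = N"
    using theI'[OF ex1_G_series[where ?'n = 'n]]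
    unfolding G_series_condition G_def G_series_def N_def .
  then have *: "fps_nth (G * (N * (1 + fps_X * crossed_var) - (fps_X + crossed_var))) k = fps_nth N k"
    for k by simp
  have N: "N = fps_const [:of_nat CARD('n):]"
    by (simp add: N_def of_nat_fps_poly)
  have "smult (of_nat CARD('n)) (fps_nth G 0 - 1) = 0"
    using *[of 0] by (simp add: crossed_var_nth N smult_diff_right algebra_simps)
  then have G0: "fps_nth G 0 = 1" by simp
  have G1: "fps_nth G (Suc 0) = 0"
    using *[of "Suc 0"] by (simp add: crossed_var_nth N)
  have "n = 0 \<or> n = Suc 0" using assms by auto
  then show ?thesis
    unfolding GRR_def GRR_entry G_def[symmetric]
    by (auto simp: crossed_var_nth G0 G1)
qed

text \<open>
  By \<open>GRR_nth_less_2\<close>, \<open>GRR\<close> is divisible by \<open>(h/u)\<^sup>2\<close>, so \<open>S(u,C) = h\<^sup>-\<^sup>2 GRR\<close> has only nonnegative powers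
  of \<open>h\<close>.  \<open>S_coeff (i,j) (k,l) m\<close> is the coefficient of
  \<open>e\<^sub>i\<^sub>j \<otimes> e\<^sub>k\<^sub>l\<close> and \<open>h\<^sup>m u\<^sup>-\<^sup>m\<^sup>-\<^sup>2\<close> in \<open>S(u,C)\<close>.
\<close>

definition S_coeff :: "('n::finite) \<times> 'n \<Rightarrow> 'n \<times> 'n \<Rightarrow> nat \<Rightarrow> complex poly" where
  "S_coeff a b m = fps_nth (GRR $ (fst a, fst b) $ (snd a, snd b)) (m + 2)"

text \<open>
  The coefficient of \<open>u\<^sup>p v\<^sup>q\<close> in \<open>f(u-v)\<close>, where \<open>f(w) = \<Sum>\<^sub>k f\<^sub>k w\<^sup>-\<^sup>k\<close> and
  \<open>(u-v)\<^sup>-\<^sup>k = \<Sum>\<^sub>q binom(k+q-1, q) u\<^sup>-\<^sup>k\<^sup>-\<^sup>q v\<^sup>q\<close> is expanded in nonnegative powers of \<open>v\<close>;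
  only \<open>k = -p-q\<close> contributes.
\<close>

definition diff_coeff :: "(nat \<Rightarrow> 'a::ring_1) \<Rightarrow> int \<Rightarrow> int \<Rightarrow> 'a" where
  "diff_coeff f p q =
     (if q \<ge> 0 \<and> p + q \<le> 0
      then of_nat ((nat (- p) - 1) choose nat q) * f (nat (- (p + q)))
      else 0)"


section \<open>The algebra \<open>H(C)\<close>\<close>

datatype 'g monomial = Monomial (letters: "'g list")

instantiation monomial :: (type) monoid_add
begin
definition "0 = Monomial []"
definition "x + y = Monomial (letters x @ letters y)"
instance by standard (auto simp: zero_monomial_def plus_monomial_def)
end

datatype 'n HC_gen = Cen | Y 'n int

text \<open>The free algebra on the generators over \<open>C[[h]]\<close>, \<open>h\<close>-adically completed.\<close>

type_synonym 'n free_alg = "('n HC_gen monomial \<Rightarrow>\<^sub>0 complex) fps"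

definition free_gen :: "'n HC_gen \<Rightarrow> 'n free_alg" where
  "free_gen g = fps_const (Poly_Mapping.single (Monomial [g]) 1)"

text \<open>The coefficient of \<open>u\<^sup>-\<^sup>k\<close> in \<open>s\<^sub>i\<^sub>j(u,C)\<close>.\<close>

definition s_free :: "'n::finite \<Rightarrow> 'n \<Rightarrow> nat \<Rightarrow> 'n free_alg" where
  "s_free i j k =
     (if k < 2 then 0
      else let p = S_coeff (i, i) (j, j) (k - 2)
           in fps_X ^ (k - 2) *
              (\<Sum>d\<le>degree p. of_series (fps_const (coeff p d)) * free_gen Cen ^ d))"

text \<open>
  The third family consists of the coefficients of \<open>u\<^sup>-\<^sup>r\<^sup>-\<^sup>1 v\<^sup>-\<^sup>s\<^sup>-\<^sup>1\<close> in
  \<open>y\<^sup>i(u)y\<^sup>j(v) + s\<^sub>i\<^sub>j(u-v,C) - y\<^sup>j(v)y\<^sup>i(u) - s\<^sub>i\<^sub>j(v-u,C)\<close>; the last series is expanded in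
  nonnegative powers of \<open>u\<close>.
\<close>

definition HC_rels :: "('n::finite) free_alg set" where
  "HC_rels =
     {free_gen Cen * free_gen (Y i r) - free_gen (Y i r) * free_gen Cen | i r. True} \<union>
     {(\<Sum>i\<in>UNIV. free_gen (Y i r)) | r. True} \<union>
     {free_gen (Y i r) * free_gen (Y j s) + diff_coeff (s_free i j) (- r - 1) (- s - 1)
        - free_gen (Y j s) * free_gen (Y i r) - diff_coeff (s_free i j) (- s - 1) (- r - 1)
      | i j r s. True}"

quotient_type (overloaded) 'n HC = "('n::finite) free_alg" / "\<lambda>f g. f - g \<in> h_ideal HC_rels"
  by (rule h_ideal_equivp)

instantiation HC :: (finite) "{ring, monoid_mult}"
begin
lift_definition zero_HC :: "'a HC" is 0 .
lift_definition one_HC :: "'a HC" is 1 .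
lift_definition plus_HC :: "'a HC \<Rightarrow> 'a HC \<Rightarrow> 'a HC" is "(+)" by (rule h_ideal_cong_add)
lift_definition uminus_HC :: "'a HC \<Rightarrow> 'a HC" is uminus by (rule h_ideal_cong_minus)
lift_definition minus_HC :: "'a HC \<Rightarrow> 'a HC \<Rightarrow> 'a HC" is "(-)" by (rule h_ideal_cong_diff)
lift_definition times_HC :: "'a HC \<Rightarrow> 'a HC \<Rightarrow> 'a HC" is "(*)" by (rule h_ideal_cong_mult)
instance by standard (transfer; simp add: algebra_simps h_ideal_zero)+
end

lift_definition HC_central :: "('n::finite) HC" is "free_gen Cen" .
lift_definition HC_y :: "'n::finite \<Rightarrow> int \<Rightarrow> 'n HC" is "\<lambda>i r. free_gen (Y i r)" .

lift_definition HC_scale :: "complex fps \<Rightarrow> ('n::finite) HC \<Rightarrow> 'n HC"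
  is "\<lambda>a f. of_series a * f"
  by (rule h_ideal_cong_mult) (simp_all add: h_ideal_zero)

locale HC_module = module smul
  for smul :: "complex fps \<Rightarrow> 'w::ab_group_add \<Rightarrow> 'w" +
  fixes W :: "'w set" and act :: "('n::finite) HC \<Rightarrow> 'w \<Rightarrow> 'w"
  assumes subspace: "subspace W"
    and act_closed: "w \<in> W \<Longrightarrow> act f w \<in> W"
    and act_add_right: "v \<in> W \<Longrightarrow> w \<in> W \<Longrightarrow> act f (v + w) = act f v + act f w"
    and act_scale_right: "w \<in> W \<Longrightarrow> act f (smul a w) = smul a (act f w)"
    and act_add_left: "w \<in> W \<Longrightarrow> act (f + g) w = act f w + act g w"
    and act_scale_left: "w \<in> W \<Longrightarrow> act (HC_scale a f) w = smul a (act f w)"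
    and act_one: "w \<in> W \<Longrightarrow> act 1 w = w"
    and act_mult: "w \<in> W \<Longrightarrow> act (f * g) w = act f (act g w)"
begin

definition level :: "complex \<Rightarrow> bool" where
  "level c \<longleftrightarrow> (\<forall>w\<in>W. act HC_central w = smul (fps_const c) w)"

definition restricted :: bool where
  "restricted \<longleftrightarrow> topologically_free smul W \<and>
     (\<forall>i. \<forall>w\<in>W. h_null smul W (\<lambda>r. act (HC_y i (int r)) w))"

end


section \<open>The algebra \<open>H\<^sup>+\<^sub>N\<close> and its subalgebra\<close>

text \<open>
  The variable \<open>x\<^sub>i\<^sub>j\<^sup>(\<^sup>-\<^sup>r\<^sup>)\<close>, \<open>r \<ge> 1\<close>, is indexed by \<open>(i, j, r - 1)\<close>, where \<open>r - 1\<close> is the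
  power of \<open>u\<close> it accompanies in \<open>x\<^sup>+\<^sub>i\<^sub>j(u)\<close>.
\<close>

type_synonym 'v mpoly = "('v \<Rightarrow>\<^sub>0 nat) \<Rightarrow>\<^sub>0 complex"

definition mvar :: "'v \<Rightarrow> 'v mpoly" where
  "mvar v = Poly_Mapping.single (Poly_Mapping.single v 1) 1"

definition trace_rels :: "('n::finite \<times> 'n \<times> nat) mpoly fps set" where
  "trace_rels = {fps_const (\<Sum>i\<in>UNIV. mvar (i, i, m)) | m. True}"

quotient_type (overloaded) 'n Hplus = "('n::finite \<times> 'n \<times> nat) mpoly fps" /
    "\<lambda>f g. f - g \<in> h_ideal trace_rels"
  by (rule h_ideal_equivp)

instantiation Hplus :: (finite) "{comm_ring, comm_monoid_mult}"
begin
lift_definition zero_Hplus :: "'a Hplus" is 0 .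
lift_definition one_Hplus :: "'a Hplus" is 1 .
lift_definition plus_Hplus :: "'a Hplus \<Rightarrow> 'a Hplus \<Rightarrow> 'a Hplus" is "(+)"
  by (rule h_ideal_cong_add)
lift_definition uminus_Hplus :: "'a Hplus \<Rightarrow> 'a Hplus" is uminus by (rule h_ideal_cong_minus)
lift_definition minus_Hplus :: "'a Hplus \<Rightarrow> 'a Hplus \<Rightarrow> 'a Hplus" is "(-)"
  by (rule h_ideal_cong_diff)
lift_definition times_Hplus :: "'a Hplus \<Rightarrow> 'a Hplus \<Rightarrow> 'a Hplus" is "(*)"
  by (rule h_ideal_cong_mult)
instance by standard (transfer; simp add: algebra_simps h_ideal_zero)+
end

lift_definition Hscale :: "complex fps \<Rightarrow> ('n::finite) Hplus \<Rightarrow> 'n Hplus"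
  is "\<lambda>a f. of_series a * f"
  by (rule h_ideal_cong_mult) (simp_all add: h_ideal_zero)

lemma module_Hscale: "module Hscale"
  by standard (transfer; simp add: algebra_simps of_series_add of_series_mult of_series_one
      h_ideal_zero)+

text \<open>\<open>xgen i j r\<close> is \<open>x\<^sub>i\<^sub>j\<^sup>(\<^sup>-\<^sup>r\<^sup>)\<close>; it is meant for \<open>r \<ge> 1\<close> only.\<close>

lift_definition xgen :: "'n::finite \<Rightarrow> 'n \<Rightarrow> nat \<Rightarrow> 'n Hplus"
  is "\<lambda>i j r. fps_const (mvar (i, j, r - 1))" .

inductive_set VH_alg :: "('n::finite) Hplus set" where
  "1 \<in> VH_alg"
| "r \<ge> 1 \<Longrightarrow> xgen i i r \<in> VH_alg"
| "v \<in> VH_alg \<Longrightarrow> w \<in> VH_alg \<Longrightarrow> v + w \<in> VH_alg"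
| "v \<in> VH_alg \<Longrightarrow> w \<in> VH_alg \<Longrightarrow> v * w \<in> VH_alg"
| "v \<in> VH_alg \<Longrightarrow> Hscale a v \<in> VH_alg"

text \<open>The topologically free algebra generated by a set is the \<open>h\<close>-adic closure of the
  \<open>C[[h]]\<close>-algebra it generates.\<close>

definition VH :: "('n::finite) Hplus set" where
  "VH = {v. \<forall>n. \<exists>w\<in>VH_alg. v - w \<in> hpow_sub Hscale UNIV n}"


section \<open>Matrix-valued series and the operators \<open>x(u)\<close>\<close>

text \<open>
  A series in \<open>u\<^sub>1,\<dots>,u\<^sub>n\<close> with coefficients in \<open>(End C\<^sup>N)\<^sup>\<otimes>\<^sup>n \<otimes> V\<close> is given by its coefficients:
  \<open>T [(i\<^sub>1,j\<^sub>1),\<dots>,(i\<^sub>n,j\<^sub>n)] [p\<^sub>1,\<dots>,p\<^sub>n]\<close> is the coefficient of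
  \<open>e\<^sub>i\<^sub>1\<^sub>j\<^sub>1 \<otimes> \<dots> \<otimes> e\<^sub>i\<^sub>n\<^sub>j\<^sub>n\<close> and \<open>u\<^sub>1\<^sup>p\<^sup>1 \<dots> u\<^sub>n\<^sup>p\<^sup>n\<close>.  Similarly, \<open>A (i,j) p\<close> is the coefficient of
  \<open>e\<^sub>i\<^sub>j\<close> and \<open>u\<^sup>p\<close> in an operator series \<open>A(u)\<close>.
\<close>

type_synonym ('n, 'v) tseries = "('n \<times> 'n) list \<Rightarrow> int list \<Rightarrow> 'v"
type_synonym ('n, 'v) opseries = "'n \<times> 'n \<Rightarrow> int \<Rightarrow> 'v \<Rightarrow> 'v"

text \<open>\<open>A\<^sub>0(u\<^sub>0) T(u\<^sub>1,\<dots>,u\<^sub>n)\<close>, with the zeroth tensor factor and variable put in front.\<close>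

fun apply0 :: "('n, 'v::zero) opseries \<Rightarrow> ('n, 'v) tseries \<Rightarrow> ('n, 'v) tseries" where
  "apply0 A T (m # ms) (p # ps) = A m p (T ms ps)"
| "apply0 A T _ _ = 0"

definition diag :: "('n, 'v::zero) tseries \<Rightarrow> ('n, 'v) tseries" where
  "diag T ms ps = (if \<forall>(i, j)\<in>set ms. i = j then T ms ps else 0)"

definition x_plus_prod :: "nat \<Rightarrow> ('n::finite, 'n Hplus) tseries" where
  "x_plus_prod n ms ps =
     (if length ms = n \<and> length ps = n \<and> (\<forall>p\<in>set ps. p \<ge> 0)
      then \<Prod>k<n. xgen (fst (ms ! k)) (snd (ms ! k)) (nat (ps ! k) + 1)
      else 0)"

definition x_plus :: "('n::finite, 'n Hplus) opseries" where
  "x_plus m p w = (if p \<ge> 0 then xgen (fst m) (snd m) (nat p + 1) * w else 0)"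

text \<open>The family \<open>xm i j r\<close>, \<open>r \<ge> 0\<close>, stands for the operators \<open>x\<^sub>i\<^sub>j\<^sup>(\<^sup>r\<^sup>)\<close>, the coefficients
  of \<open>u\<^sup>-\<^sup>r\<^sup>-\<^sup>1\<close> in \<open>x\<^sup>-\<^sub>i\<^sub>j(u)\<close>.\<close>

definition x_minus ::
  "('n \<Rightarrow> 'n \<Rightarrow> nat \<Rightarrow> 'n Hplus \<Rightarrow> 'n Hplus) \<Rightarrow> ('n::finite, 'n Hplus) opseries" where
  "x_minus xm m p w = (if p < 0 then xm (fst m) (snd m) (nat (- p - 1)) w else 0)"

text \<open>The coefficient of \<open>u\<^sup>-\<^sup>k\<close> in \<open>S(u,c)\<close>.\<close>

definition S_at :: "complex \<Rightarrow> 'n::finite \<times> 'n \<Rightarrow> 'n \<times> 'n \<Rightarrow> nat \<Rightarrow> complex fps" where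
  "S_at c a b k = (if k < 2 then 0 else fps_X ^ (k - 2) * fps_const (poly (S_coeff a b (k - 2)) c))"

definition delete_nth :: "nat \<Rightarrow> 'a list \<Rightarrow> 'a list" where
  "delete_nth k xs = take k xs @ drop (Suc k) xs"

text \<open>
  \<open>S\<^sub>0\<^sub>j(u\<^sub>0-u\<^sub>j) x\<^sup>+\<^sub>1(u\<^sub>1) \<dots> x\<^sup>+\<^sub>n(u\<^sub>n)\<close> with the factor \<open>x\<^sup>+\<^sub>j(u\<^sub>j)\<close> omitted, for \<open>j = k + 1\<close>
  (lists are indexed from 0).
\<close>

fun S0_omit :: "complex \<Rightarrow> nat \<Rightarrow> nat \<Rightarrow> ('n::finite, 'n Hplus) tseries" where
  "S0_omit c n k (m # ms) (p # ps) =
     (if length ms = n \<and> length ps = n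
      then Hscale (diff_coeff (S_at c m (ms ! k)) p (ps ! k))
             (x_plus_prod (n - 1) (delete_nth k ms) (delete_nth k ps))
      else 0)"
| "S0_omit c n k _ _ = 0"

definition is_x_minus ::
  "complex \<Rightarrow> ('n::finite \<Rightarrow> 'n \<Rightarrow> nat \<Rightarrow> 'n Hplus \<Rightarrow> 'n Hplus) \<Rightarrow> bool" where
  "is_x_minus c xm \<longleftrightarrow>
     (\<forall>i j r. module_hom Hscale Hscale (xm i j r)) \<and>
     (\<forall>i j w. h_null Hscale UNIV (\<lambda>r. xm i j r w)) \<and>
     (\<forall>i j r. xm i j r 1 = 0) \<and>
     (\<forall>n\<ge>1. apply0 (x_minus xm) (x_plus_prod n) =
        (\<lambda>ms ps. - (\<Sum>k<n. S0_omit c n k ms ps)))"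


section \<open>The space \<open>\<hh>\<close>\<close>

text \<open>The class of \<open>f\<close> is \<open>\<Sum>\<^sub>i f(i) a\<^sub>i\<close>; the only relation is \<open>\<Sum>\<^sub>i a\<^sub>i = 0\<close>.\<close>

quotient_type 'n cartan = "'n \<Rightarrow> complex" / "\<lambda>f g. \<exists>t. \<forall>i. f i = g i + t"
proof (rule equivpI)
  show "reflp (\<lambda>f g :: 'n \<Rightarrow> complex. \<exists>t. \<forall>i. f i = g i + t)"
    unfolding reflp_def by (intro allI exI[of _ 0]) simp
  show "symp (\<lambda>f g :: 'n \<Rightarrow> complex. \<exists>t. \<forall>i. f i = g i + t)"
    unfolding symp_def
  proof safe
    fix f g :: "'n \<Rightarrow> complex" and t
    assume "\<forall>i. f i = g i + t"
    then show "\<exists>t. \<forall>i. g i = f i + t" by (intro exI[of _ "- t"]) simp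
  qed
  show "transp (\<lambda>f g :: 'n \<Rightarrow> complex. \<exists>t. \<forall>i. f i = g i + t)"
    unfolding transp_def
  proof safe
    fix f g k :: "'n \<Rightarrow> complex" and s t
    assume "\<forall>i. f i = g i + t" "\<forall>i. g i = k i + s"
    then show "\<exists>t. \<forall>i. f i = k i + t" by (intro exI[of _ "s + t"]) simp
  qed
qed

instantiation cartan :: (type) ab_group_add
begin
lift_definition zero_cartan :: "'a cartan" is "\<lambda>_. 0" .
lift_definition plus_cartan :: "'a cartan \<Rightarrow> 'a cartan \<Rightarrow> 'a cartan" is "\<lambda>f g i. f i + g i"
proof (elim exE)
  fix f f' g g' :: "'a \<Rightarrow> complex" and s t
  assume "\<forall>i. f i = f' i + s" "\<forall>i. g i = g' i + t"
  then show "\<exists>t. \<forall>i. f i + g i = f' i + g' i + t" by (intro exI[of _ "s + t"]) simp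
qed
lift_definition uminus_cartan :: "'a cartan \<Rightarrow> 'a cartan" is "\<lambda>f i. - f i"
proof (elim exE)
  fix f f' :: "'a \<Rightarrow> complex" and s
  assume "\<forall>i. f i = f' i + s"
  then show "\<exists>t. \<forall>i. - f i = - f' i + t" by (intro exI[of _ "- s"]) simp
qed
lift_definition minus_cartan :: "'a cartan \<Rightarrow> 'a cartan \<Rightarrow> 'a cartan" is "\<lambda>f g i. f i - g i"
proof (elim exE)
  fix f f' g g' :: "'a \<Rightarrow> complex" and s t
  assume "\<forall>i. f i = f' i + s" "\<forall>i. g i = g' i + t"
  then show "\<exists>t. \<forall>i. f i - g i = f' i - g' i + t" by (intro exI[of _ "s - t"]) simp
qed
instance by standard (transfer; rule exI[of _ 0]; simp)+
end

lift_definition cartan_scale :: "complex \<Rightarrow> 'n cartan \<Rightarrow> 'n cartan" is "\<lambda>z f i. z * f i"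
proof (elim exE)
  fix f f' :: "'n \<Rightarrow> complex" and z s
  assume "\<forall>i. f i = f' i + s"
  then show "\<exists>t. \<forall>i. z * f i = z * f' i + t"
    by (intro exI[of _ "z * s"]) (simp add: distrib_left)
qed

global_interpretation cartan: vector_space cartan_scale
  by standard (transfer; rule exI[of _ 0]; simp add: algebra_simps)+

lift_definition cartan_gen :: "'n \<Rightarrow> 'n cartan" is "\<lambda>i k. if k = i then 1 else 0" .

lemma cartan_form_aux:
  fixes f g :: "'n::finite \<Rightarrow> complex"
  assumes "\<And>i. f i = f' i + t" "\<And>i. g i = g' i + s"
  shows "(\<Sum>i\<in>UNIV. \<Sum>j\<in>UNIV. f i * g j * ((if i = j then 1 else 0) - 1 / of_nat CARD('n))) =
         (\<Sum>i\<in>UNIV. \<Sum>j\<in>UNIV. f' i * g' j * ((if i = j then 1 else 0) - 1 / of_nat CARD('n)))"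
proof -
  define B :: "'n \<Rightarrow> 'n \<Rightarrow> complex"
    where "B i j = (if i = j then 1 else 0) - 1 / of_nat CARD('n)" for i j
  have B0: "(\<Sum>j\<in>UNIV. B i j) = 0" "(\<Sum>j\<in>UNIV. B j i) = 0" for i
    by (simp_all add: B_def sum_subtractf)
  have "(\<Sum>j\<in>UNIV. f i * g j * B i j) = (\<Sum>j\<in>UNIV. f i * g' j * B i j)" for i
  proof -
    have "(\<Sum>j\<in>UNIV. f i * g j * B i j) =
        (\<Sum>j\<in>UNIV. f i * g' j * B i j) + f i * s * (\<Sum>j\<in>UNIV. B i j)"
      unfolding sum_distrib_left sum.distrib[symmetric]
      by (rule sum.cong) (simp_all only: assms(2) ring_distribs)
    then show ?thesis by (simp only: B0 mult_zero_right add_0_right)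
  qed
  moreover have "(\<Sum>i\<in>UNIV. f i * g' j * B i j) = (\<Sum>i\<in>UNIV. f' i * g' j * B i j)" for j
  proof -
    have "(\<Sum>i\<in>UNIV. f i * g' j * B i j) =
        (\<Sum>i\<in>UNIV. f' i * g' j * B i j) + t * g' j * (\<Sum>i\<in>UNIV. B i j)"
      unfolding sum_distrib_left sum.distrib[symmetric]
      by (rule sum.cong) (simp_all only: assms(1) ring_distribs)
    then show ?thesis by (simp only: B0 mult_zero_right add_0_right)
  qed
  moreover have "(\<Sum>i\<in>UNIV. \<Sum>j\<in>UNIV. k i * g' j * B i j) =
      (\<Sum>j\<in>UNIV. \<Sum>i\<in>UNIV. k i * g' j * B i j)" for k
    by (rule sum.swap)
  ultimately show ?thesis unfolding B_def[symmetric] by (simp only:)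
qed

lift_definition cartan_form :: "('n::finite) cartan \<Rightarrow> 'n cartan \<Rightarrow> complex" is
  "\<lambda>f g. \<Sum>i\<in>UNIV. \<Sum>j\<in>UNIV. f i * g j * ((if i = j then 1 else 0) - 1 / of_nat CARD('n))"
proof -
  fix f f' g g' :: "'n \<Rightarrow> complex"
  assume "\<exists>t. \<forall>i. f i = f' i + t" "\<exists>s. \<forall>i. g i = g' i + s"
  then obtain t s where "\<And>i. f i = f' i + t" "\<And>i. g i = g' i + s" by blast
  then show "(\<Sum>i\<in>UNIV. \<Sum>j\<in>UNIV. f i * g j * ((if i = j then 1 else 0) - 1 / of_nat CARD('n))) =
         (\<Sum>i\<in>UNIV. \<Sum>j\<in>UNIV. f' i * g' j * ((if i = j then 1 else 0) - 1 / of_nat CARD('n)))"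
    by (rule cartan_form_aux)
qed

text \<open>The \<open>C[[h]]\<close>-bilinear extension of the form to \<open>\<hh>[[h]]\<close>.\<close>

definition cartan_form_h :: "('n::finite) cartan fps \<Rightarrow> 'n cartan fps \<Rightarrow> complex fps" where
  "cartan_form_h f g = Abs_fps (\<lambda>n. \<Sum>k\<le>n. cartan_form (fps_nth f k) (fps_nth g (n - k)))"

definition low_indices :: "('n::{finite,linorder}) set" where
  "low_indices = {j. \<exists>k. j < k}"

definition cartan_hat :: "('n \<Rightarrow> 'n \<Rightarrow> complex) \<Rightarrow> 'n \<Rightarrow> ('n::{finite,linorder}) cartan" where
  "cartan_hat \<nu> j = (\<Sum>i\<in>{..j}. cartan_scale (\<nu> i j) (cartan_gen i))"

definition orthonormal_basis :: "('n::{finite,linorder} \<Rightarrow> 'n \<Rightarrow> complex) \<Rightarrow> bool" where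
  "orthonormal_basis \<nu> \<longleftrightarrow>
     inj_on (cartan_hat \<nu>) low_indices \<and>
     cartan.independent (cartan_hat \<nu> ` low_indices) \<and>
     cartan.span (cartan_hat \<nu> ` low_indices) = (UNIV :: 'n cartan set) \<and>
     (\<forall>j\<in>low_indices. \<forall>k\<in>low_indices.
        cartan_form (cartan_hat \<nu> j) (cartan_hat \<nu> k) = (if j = k then 1 else 0))"


section \<open>The module\<close>

definition y_series :: "(('n::finite) HC \<Rightarrow> 'n Hplus \<Rightarrow> 'n Hplus) \<Rightarrow> ('n, 'n Hplus) opseries" where
  "y_series act m p w = (if fst m = snd m then act (HC_y (fst m) (- p - 1)) w else 0)"

text \<open>\<open>u\<^sup>-\<^sup>1 a(\<alpha>)\<close>\<close>

definition a_series :: "('n::finite) cartan fps \<Rightarrow> ('n, 'n Hplus) opseries" where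
  "a_series \<alpha> m p w =
     (if fst m = snd m \<and> p = - 1
      then Hscale (cartan_form_h (fps_const (cartan_gen (fst m))) \<alpha>) w else 0)"

text \<open>\<open>act\<close> is the structure of restricted \<open>H(C)\<close>-module of level \<open>c\<close> on
  \<^const>\<open>VH\<close> attached to \<open>\<alpha>\<close>;
  \<open>xm\<close> is the family of coefficients of \<open>x\<^sup>-(u)\<close>.\<close>

definition is_VH_module ::
  "complex \<Rightarrow> ('n::finite) cartan fps \<Rightarrow> ('n \<Rightarrow> 'n \<Rightarrow> nat \<Rightarrow> 'n Hplus \<Rightarrow> 'n Hplus) \<Rightarrow>
   ('n HC \<Rightarrow> 'n Hplus \<Rightarrow> 'n Hplus) \<Rightarrow> bool" where
  "is_VH_module c \<alpha> xm act \<longleftrightarrow>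
     HC_module Hscale VH act \<and>
     HC_module.level Hscale VH act c \<and>
     HC_module.restricted Hscale VH act \<and>
     (\<forall>n. apply0 (y_series act) (diag (x_plus_prod n)) =
        diag (apply0 (\<lambda>m p w. x_plus m p w + x_minus xm m p w + a_series \<alpha> m p w)
               (x_plus_prod n)))"

definition y_hat :: "('n \<Rightarrow> 'n \<Rightarrow> complex) \<Rightarrow> 'n \<Rightarrow> int \<Rightarrow> ('n::{finite,linorder}) HC" where
  "y_hat \<nu> j r = (\<Sum>i\<in>{..j}. HC_scale (fps_const (\<nu> i j)) (HC_y i r))"

definition x_hat :: "('n \<Rightarrow> 'n \<Rightarrow> complex) \<Rightarrow> 'n \<Rightarrow> nat \<Rightarrow> ('n::{finite,linorder}) Hplus" where
  "x_hat \<nu> j r = (\<Sum>i\<in>{..j}. Hscale (fps_const (\<nu> i j)) (xgen i i r))"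


section \<open>Partial derivatives\<close>

text \<open>
  The variable \<open>(j, r - 1)\<close> of the polynomial ring below corresponds to the generator
  \<open>x_hat \<nu> j r\<close>, \<open>r \<ge> 1\<close>.
\<close>

definition mpoly_subst :: "('v \<Rightarrow> 'w mpoly) \<Rightarrow> 'v mpoly \<Rightarrow> 'w mpoly" where
  "mpoly_subst g p = (\<Sum>m\<in>Poly_Mapping.keys p. Poly_Mapping.single 0 (Poly_Mapping.lookup p m) *
     (\<Prod>v\<in>Poly_Mapping.keys m. g v ^ Poly_Mapping.lookup m v))"

definition mpoly_deriv :: "'v \<Rightarrow> 'v mpoly \<Rightarrow> 'v mpoly" where
  "mpoly_deriv v p = (\<Sum>m\<in>Poly_Mapping.keys p.
     Poly_Mapping.single (m - Poly_Mapping.single v 1)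
       (Poly_Mapping.lookup p m * of_nat (Poly_Mapping.lookup m v)))"

definition hat_polys :: "('n::{finite,linorder} \<times> nat) mpoly fps set" where
  "hat_polys = {f. \<forall>n. \<forall>m\<in>Poly_Mapping.keys (fps_nth f n). Poly_Mapping.keys m \<subseteq> low_indices \<times> UNIV}"

text \<open>
  The identification of the topological polynomial ring in the variables \<open>x_hat \<nu> j r\<close> with
  \<^const>\<open>VH\<close>: substitution is carried out coefficientwise in \<open>h\<close>, on representatives.
\<close>

lift_definition hat_eval ::
  "('n::{finite,linorder} \<Rightarrow> 'n \<Rightarrow> complex) \<Rightarrow> ('n \<times> nat) mpoly fps \<Rightarrow> 'n Hplus"
  is "\<lambda>\<nu> f. Abs_fps (\<lambda>n. mpoly_subst
        (\<lambda>(j, m). \<Sum>i\<in>{..j}. Poly_Mapping.single 0 (\<nu> i j) * mvar (i, i, m)) (fps_nth f n))" .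

definition x_hat_deriv ::
  "('n \<Rightarrow> 'n \<Rightarrow> complex) \<Rightarrow> 'n \<Rightarrow> nat \<Rightarrow> 'n Hplus \<Rightarrow> ('n::{finite,linorder}) Hplus" where
  "x_hat_deriv \<nu> j r w =
     hat_eval \<nu> (Abs_fps (\<lambda>n. mpoly_deriv (j, r - 1)
       (fps_nth (inv_into hat_polys (hat_eval \<nu>) w) n)))"

end

theory Submission
  imports Defs
begin

text \<open>
  On products of the generators \<open>x_ii\<close> the defining formula for \<open>x\<^sup>-(u)\<close> says exactly that \<open>y_i\<^sup>(\<^sup>r\<^sup>)\<close>, \<open>r \<ge> 1\<close>, is
  a derivation whose commutator with multiplication by \<open>x_ll\<^sup>(\<^sup>-\<^sup>s\<^sup>)\<close> is a scalar, a coefficient of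
  \<open>S(u - v)\<close>.  Modulo \<open>h\<close> only the \<open>u\<^sup>-\<^sup>2\<close> term of \<open>S\<close> survives; it equals \<open>-c\<langle>a_i,a_l\<rangle>\<close>, so for an
  orthonormal basis the commutators become \<open>rc\<close> times Kronecker deltas.  To read off the action on the
  completed space one needs that every element of \<^const>\<open>VH\<close> is a power series in \<open>h\<close> over polynomials in the
  \<open>x_hat\<close>.  This follows from the substitution \<open>x_ii \<mapsto> \<Sum>\<^sub>k \<langle>a_i, hat a_k\<rangle> x_hat_k\<close>: it kills the trace
  relations, it splits the evaluation map on the uncompleted subalgebra, and hence on its closure.
\<close>

section \<open>Substitution and derivatives of polynomials\<close>

lemma poly_mapping_sum_single:
  "(\<Sum>m\<in>Poly_Mapping.keys p. Poly_Mapping.single m (Poly_Mapping.lookup p m)) = p"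
proof (rule poly_mapping_eqI)
  fix k
  have "(\<Sum>m\<in>Poly_Mapping.keys p. if m = k then Poly_Mapping.lookup p m else 0) =
      Poly_Mapping.lookup p k"
    by (simp add: not_in_keys_iff_lookup_eq_zero)
  then show "Poly_Mapping.lookup
      (\<Sum>m\<in>Poly_Mapping.keys p. Poly_Mapping.single m (Poly_Mapping.lookup p m)) k =
      Poly_Mapping.lookup p k"
    by (simp add: lookup_sum lookup_single when_def)
qed

text \<open>Exponents and polynomials are both finitely supported functions, so one principle serves
  both: with natural number values it runs over exponents, with complex values over
  polynomials.\<close>

lemma poly_mapping_additive_induct [consumes 1, case_names zero single add]:
  fixes p :: "'a \<Rightarrow>\<^sub>0 'b::comm_monoid_add"
  assumes "Poly_Mapping.keys p \<subseteq> A"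
    and "P 0"
    and "\<And>m c. m \<in> A \<Longrightarrow> P (Poly_Mapping.single m c)"
    and "\<And>p q. P p \<Longrightarrow> P q \<Longrightarrow> P (p + q)"
  shows "P p"
proof -
  have "P (\<Sum>m\<in>B. Poly_Mapping.single m (Poly_Mapping.lookup p m))" if "finite B" "B \<subseteq> A" for B
    using that by (induction rule: finite_induct) (auto intro: assms)
  from this[OF finite_keys assms(1)] show ?thesis
    by (simp only: poly_mapping_sum_single)
qed

lemma exponent_induct [consumes 1, case_names zero step]:
  fixes m :: "'v \<Rightarrow>\<^sub>0 nat"
  assumes "Poly_Mapping.keys m \<subseteq> V"
    and zero: "P 0"
    and step: "\<And>v m. v \<in> V \<Longrightarrow> P m \<Longrightarrow> P (Poly_Mapping.single v 1 + m)"
  shows "P m"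
proof -
  \<comment> \<open>\<open>step\<close> adds a variable to an exponent that already satisfies
    \<open>P\<close>, so sums of exponents are reached only when the claim is generalised over the
    starting exponent \<open>m'\<close>.\<close>
  have "\<forall>m'. P m' \<longrightarrow> P (m + m')"
    using assms(1)
  proof (induction rule: poly_mapping_additive_induct)
    case (single v k)
    have "P (Poly_Mapping.single v k + m')" if "P m'" for m'
    proof (induction k)
      case (Suc k)
      have "Poly_Mapping.single v (Suc k) + m' =
          Poly_Mapping.single v 1 + (Poly_Mapping.single v k + m')"
        by (simp add: add.assoc[symmetric] flip: single_add)
      with step[OF single Suc] show ?case by (simp only:)
    qed (use that in simp)
    then show ?case by blast
  qed (auto simp: add.assoc)
  with zero have "P (m + 0)" by blast
  then show ?thesis by simp
qed

definition mpoly_vars_in :: "'v set \<Rightarrow> 'v mpoly set" where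
  "mpoly_vars_in V = {p. \<forall>m\<in>Poly_Mapping.keys p. Poly_Mapping.keys m \<subseteq> V}"

lemma mpoly_vars_in_add:
  "p \<in> mpoly_vars_in V \<Longrightarrow> q \<in> mpoly_vars_in V \<Longrightarrow> p + q \<in> mpoly_vars_in V"
  using keys_add[of p q] by (auto simp: mpoly_vars_in_def)

text \<open>The \<open>mvar\<close> case multiplies a single term rather than a polynomial, to match
  the form of the Leibniz rule below.\<close>

lemma mpoly_induct [consumes 1, case_names const add mvar]:
  assumes "p \<in> mpoly_vars_in V"
    and const: "\<And>c. P (Poly_Mapping.single 0 c)"
    and add: "\<And>p q. p \<in> mpoly_vars_in V \<Longrightarrow> q \<in> mpoly_vars_in V \<Longrightarrow> P p \<Longrightarrow> P q \<Longrightarrow> P (p + q)"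
    and mvar: "\<And>v m c. v \<in> V \<Longrightarrow> Poly_Mapping.keys m \<subseteq> V \<Longrightarrow> P (Poly_Mapping.single m c) \<Longrightarrow>
      P (mvar v * Poly_Mapping.single m c)"
  shows "P p"
proof -
  have "Poly_Mapping.keys p \<subseteq> {m. Poly_Mapping.keys m \<subseteq> V}"
    using assms(1) by (auto simp: mpoly_vars_in_def)
  then have "p \<in> mpoly_vars_in V \<and> P p"
  proof (induction rule: poly_mapping_additive_induct)
    case zero
    show ?case using const[of 0] by (simp add: mpoly_vars_in_def)
  next
    case (single m c)
    then have m: "Poly_Mapping.keys m \<subseteq> V" by simp
    then have "Poly_Mapping.keys m \<subseteq> V \<and> P (Poly_Mapping.single m c)"
    proof (induction rule: exponent_induct)
      case zero
      show ?case using const by simp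
    next
      case (step v m)
      then show ?case
        using mvar[of v m] keys_add[of "Poly_Mapping.single v 1" m]
        by (auto simp: mvar_def mult_single)
    qed
    with m show ?case by (simp add: mpoly_vars_in_def)
  qed (blast intro: add mpoly_vars_in_add)
  then show ?thesis ..
qed

section \<open>Substitution as a ring homomorphism\<close>

definition monom_eval :: "('v \<Rightarrow> 'a::comm_monoid_mult) \<Rightarrow> ('v \<Rightarrow>\<^sub>0 nat) \<Rightarrow> 'a" where
  "monom_eval g m = (\<Prod>v\<in>Poly_Mapping.keys m. g v ^ Poly_Mapping.lookup m v)"

text \<open>The supports of two exponents and of their sum differ; padding with factors of exponent
  zero puts their products over a common index set.\<close>

lemma monom_eval_superset:
  assumes "finite A" "Poly_Mapping.keys m \<subseteq> A"
  shows "monom_eval g m = (\<Prod>v\<in>A. g v ^ Poly_Mapping.lookup m v)"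
  unfolding monom_eval_def
  by (rule prod.mono_neutral_left) (use assms in \<open>auto simp: not_in_keys_iff_lookup_eq_zero\<close>)

lemma monom_eval_add: "monom_eval g (m + m') = monom_eval g m * monom_eval g m'"
proof -
  let ?A = "Poly_Mapping.keys m \<union> Poly_Mapping.keys m'"
  have "finite ?A" by simp
  then show ?thesis
    by (subst (1 2 3) monom_eval_superset[of ?A])
      (auto simp: keys_add lookup_add power_add prod.distrib)
qed

lemma monom_eval_zero [simp]: "monom_eval g 0 = 1"
  by (simp add: monom_eval_def)

lemma monom_eval_single [simp]: "monom_eval g (Poly_Mapping.single v 1) = g v"
  by (simp add: monom_eval_def)

lemma mpoly_subst_conv_monom_eval:
  "mpoly_subst g p =
     (\<Sum>m\<in>Poly_Mapping.keys p. Poly_Mapping.single 0 (Poly_Mapping.lookup p m) * monom_eval g m)"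
  by (simp add: mpoly_subst_def monom_eval_def)

lemma mpoly_subst_zero [simp]: "mpoly_subst g 0 = 0"
  by (simp add: mpoly_subst_def)

lemma mpoly_subst_add: "mpoly_subst g (p + q) = mpoly_subst g p + mpoly_subst g q"
  unfolding mpoly_subst_conv_monom_eval
  by (rule setsum_keys_plus_distrib) (simp_all add: single_add ring_distribs)

lemma mpoly_subst_single:
  "mpoly_subst g (Poly_Mapping.single m c) = Poly_Mapping.single 0 c * monom_eval g m"
  by (cases "c = 0") (simp_all add: mpoly_subst_conv_monom_eval)

lemma mpoly_subst_mvar [simp]: "mpoly_subst g (mvar v) = g v"
  by (simp add: mvar_def mpoly_subst_single del: One_nat_def)

text \<open>Both sides are biadditive, which leaves a product of two terms, where exponents add and
  \<open>monom_eval\<close> is multiplicative.\<close>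

lemma mpoly_subst_mult: "mpoly_subst g (p * q) = mpoly_subst g p * mpoly_subst g q"
proof -
  have 1: "mpoly_subst g (Poly_Mapping.single m c * q) =
      mpoly_subst g (Poly_Mapping.single m c) * mpoly_subst g q" for m c
    using subset_UNIV[of "Poly_Mapping.keys q"]
  proof (induction q rule: poly_mapping_additive_induct)
    case (single m' c')
    have const: "Poly_Mapping.single 0 (c * c') = Poly_Mapping.single 0 c * Poly_Mapping.single 0 c'"
      by (simp add: mult_single)
    show ?case
      unfolding mult_single[of m c m' c'] mpoly_subst_single monom_eval_add const
      by (simp only: mult_ac)
  qed (simp_all add: mpoly_subst_add distrib_left)
  show ?thesis
    using subset_UNIV[of "Poly_Mapping.keys p"]
    by (induction p rule: poly_mapping_additive_induct)
      (simp_all add: 1 mpoly_subst_add distrib_right)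
qed

lemma mpoly_subst_const [simp]:
  "mpoly_subst g (Poly_Mapping.single 0 c) = Poly_Mapping.single 0 c"
  by (simp add: mpoly_subst_single)

lemma mpoly_subst_sum: "mpoly_subst g (\<Sum>i\<in>A. f i) = (\<Sum>i\<in>A. mpoly_subst g (f i))"
  by (induction A rule: infinite_finite_induct) (simp_all add: mpoly_subst_add)

section \<open>Formal partial derivatives\<close>

lemma mpoly_deriv_add: "mpoly_deriv v (p + q) = mpoly_deriv v p + mpoly_deriv v q"
  unfolding mpoly_deriv_def
  by (rule setsum_keys_plus_distrib) (simp_all add: single_add ring_distribs)

lemma mpoly_deriv_single:
  "mpoly_deriv v (Poly_Mapping.single m c) =
     Poly_Mapping.single (m - Poly_Mapping.single v 1) (c * of_nat (Poly_Mapping.lookup m v))"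
  by (cases "c = 0") (simp_all add: mpoly_deriv_def)

lemma mpoly_deriv_const [simp]: "mpoly_deriv v (Poly_Mapping.single 0 c) = 0"
  by (simp add: mpoly_deriv_single)

lemma mpoly_deriv_mvar_mult:
  "mpoly_deriv v (mvar u * Poly_Mapping.single m c) =
     mvar u * mpoly_deriv v (Poly_Mapping.single m c) +
     (if u = v then Poly_Mapping.single m c else 0)"
proof -
  let ?e = "\<lambda>v. Poly_Mapping.single v (1::nat)"
  \<comment> \<open>Subtraction of exponents is truncated at zero, so it can be moved past the added
    variable when \<open>v\<close> occurs in \<open>m\<close>; otherwise the derivative of the term
    on the right has coefficient zero.\<close>
  consider "Poly_Mapping.lookup m v = 0" | "?e u + m - ?e v = ?e u + (m - ?e v)"
  proof (cases "Poly_Mapping.lookup m v = 0")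
    case False
    then have "?e u + m - ?e v = ?e u + (m - ?e v)"
      by (intro poly_mapping_eqI) (auto simp: lookup_add lookup_minus lookup_single when_def)
    then show thesis by (rule that)
  qed (rule that)
  then show ?thesis
  proof cases
    case 1
    then show ?thesis
      by (auto simp: mvar_def mult_single mpoly_deriv_single lookup_add lookup_single)
  next
    case 2
    have "?e v + m - ?e v = m" by simp
    with 2 show ?thesis
      by (auto simp: mvar_def mult_single mpoly_deriv_single lookup_add lookup_single
        ring_distribs add.commute[of c] simp flip: single_add)
  qed
qed

lemma keys_mpoly_deriv:
  assumes "\<forall>m\<in>Poly_Mapping.keys p. Poly_Mapping.keys m \<subseteq> V"
    and "m \<in> Poly_Mapping.keys (mpoly_deriv v p)"
  shows "Poly_Mapping.keys m \<subseteq> V"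
proof -
  obtain m' where m': "m' \<in> Poly_Mapping.keys p" "m = m' - Poly_Mapping.single v 1"
    using assms(2) keys_sum[of _ "Poly_Mapping.keys p"] unfolding mpoly_deriv_def
    by (fastforce split: if_splits)
  have "Poly_Mapping.keys (m' - Poly_Mapping.single v 1) \<subseteq> Poly_Mapping.keys m'"
    by (auto simp: in_keys_iff lookup_minus)
  with m' assms(1) show ?thesis by blast
qed

lemma mpoly_vars_in_mult:
  assumes "p \<in> mpoly_vars_in V" "q \<in> mpoly_vars_in V"
  shows "p * q \<in> mpoly_vars_in V"
proof -
  have "Poly_Mapping.keys m \<subseteq> V" if "m \<in> Poly_Mapping.keys (p * q)" for m
  proof -
    from that keys_mult[of p q] obtain a b
      where "m = a + b" "a \<in> Poly_Mapping.keys p" "b \<in> Poly_Mapping.keys q" by blast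
    with assms keys_add[of a b] show ?thesis by (fastforce simp: mpoly_vars_in_def)
  qed
  then show ?thesis by (simp add: mpoly_vars_in_def)
qed

lemma mpoly_vars_in_const [simp]: "Poly_Mapping.single 0 c \<in> mpoly_vars_in V"
  by (simp add: mpoly_vars_in_def)

lemma mpoly_vars_in_mvar: "v \<in> V \<Longrightarrow> mvar v \<in> mpoly_vars_in V"
  by (simp add: mpoly_vars_in_def mvar_def)

lemma mpoly_vars_in_sum:
  "(\<And>i. i \<in> A \<Longrightarrow> f i \<in> mpoly_vars_in V) \<Longrightarrow> (\<Sum>i\<in>A. f i) \<in> mpoly_vars_in V"
  by (induction A rule: infinite_finite_induct)
    (auto intro: mpoly_vars_in_add simp: mpoly_vars_in_const[of 0, simplified])

lemma mpoly_subst_vars_in: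
  assumes "\<And>v. g v \<in> mpoly_vars_in V"
  shows "mpoly_subst g p \<in> mpoly_vars_in V"
proof -
  have "p \<in> mpoly_vars_in UNIV" by (simp add: mpoly_vars_in_def)
  then show ?thesis
    by (induction rule: mpoly_induct)
      (simp_all add: mpoly_subst_add mpoly_subst_mult mpoly_vars_in_add mpoly_vars_in_mult assms)
qed

section \<open>Coordinates on the polynomial algebra\<close>

definition subst_h :: "('v \<Rightarrow> 'w mpoly) \<Rightarrow> 'v mpoly fps \<Rightarrow> 'w mpoly fps" where
  "subst_h g f = Abs_fps (\<lambda>n. mpoly_subst g (fps_nth f n))"

lemma subst_h_nth [simp]: "fps_nth (subst_h g f) n = mpoly_subst g (fps_nth f n)"
  by (simp add: subst_h_def)

lemma mpoly_subst_diff: "mpoly_subst g (p - q) = mpoly_subst g p - mpoly_subst g q"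
  using mpoly_subst_add[of g "p - q" q] by (simp add: algebra_simps)

lemma subst_h_zero [simp]: "subst_h g 0 = 0"
  by (simp add: fps_eq_iff)

lemma subst_h_add: "subst_h g (f + f') = subst_h g f + subst_h g f'"
  by (simp add: fps_eq_iff mpoly_subst_add)

lemma subst_h_diff: "subst_h g (f - f') = subst_h g f - subst_h g f'"
  by (simp add: fps_eq_iff mpoly_subst_diff)

lemma subst_h_mult: "subst_h g (f * f') = subst_h g f * subst_h g f'"
  by (simp add: fps_eq_iff fps_mult_nth mpoly_subst_sum mpoly_subst_mult)

lemma subst_h_const: "subst_h g (fps_const p) = fps_const (mpoly_subst g p)"
  by (simp add: fps_eq_iff)

lemma subst_h_of_series [simp]: "subst_h g (of_series a) = of_series a"
  by (simp add: fps_eq_iff of_series_def)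

lemma of_series_const: "of_series (fps_const z) = fps_const (Poly_Mapping.single 0 z)"
  by (simp add: fps_eq_iff of_series_def)

lemma of_series_X_power: "of_series (fps_X ^ n) = fps_X ^ n"
  by (simp add: fps_eq_iff of_series_def fps_X_power_nth)

lemma of_series_zero [simp]: "of_series 0 = 0"
  by (simp add: fps_eq_iff of_series_def)

interpretation Hplus: module Hscale
  by (rule module_Hscale)

lemma Hscale_mult_left: "Hscale a v * w = Hscale a (v * w)"
  by transfer (simp add: mult.assoc h_ideal_zero)

lemma Hscale_mult_right: "v * Hscale a w = Hscale a (v * w)"
  by (metis Hscale_mult_left mult.commute)

lemma hpow_sub_iff: "v \<in> hpow_sub smul W n \<longleftrightarrow> (\<exists>w\<in>W. v = smul (fps_X ^ n) w)"
  by (auto simp: hpow_sub_def)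

lemma abs_Hplus_cases:
  obtains g where "v = abs_Hplus g"
  using that[of "rep_Hplus v"] by (simp add: Quotient_abs_rep[OF Quotient_Hplus])

text \<open>The ideal divided out is \<open>h\<close>-adically closed: a representative congruent to
  a multiple of \<open>h^n\<close> for every \<open>n\<close> is approximated by the trace ideal to
  every order, hence lies in \<open>h_ideal trace_rels\<close>.\<close>

lemma Hplus_separated:
  fixes v :: "'n::finite Hplus"
  assumes "\<And>n. v \<in> hpow_sub Hscale UNIV n"
  shows "v = 0"
proof -
  obtain g where v: "v = abs_Hplus g" by (rule abs_Hplus_cases)
  have "g - 0 \<in> h_ideal trace_rels"
    unfolding h_ideal_def
  proof (intro CollectI allI)
    fix n
    obtain w where w: "v = Hscale (fps_X ^ n) w"
      using assms[of n] by (auto simp: hpow_sub_iff)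
    obtain k where k: "w = abs_Hplus k" by (rule abs_Hplus_cases)
    have "g - fps_X ^ n * k \<in> h_ideal trace_rels"
      using w unfolding v k by (simp add: Hscale.abs_eq Hplus.abs_eq_iff of_series_X_power)
    then obtain g' k' where g': "g' \<in> ideal_gen trace_rels"
      "g - fps_X ^ n * k - g' = fps_X ^ n * k'"
      unfolding h_ideal_def by blast
    then have "g - 0 - g' = fps_X ^ n * (k + k')" by (simp add: algebra_simps)
    with g' show "\<exists>g'\<in>ideal_gen trace_rels. \<exists>k. g - 0 - g' = fps_X ^ n * k" by blast
  qed
  then show ?thesis
    unfolding v zero_Hplus_def by (simp add: Hplus.abs_eq_iff)
qed

section \<open>The bilinear form on the Cartan space\<close>

lemma cartan_form_add_left: "cartan_form (x + y) z = cartan_form x z + cartan_form y z"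
proof transfer
  fix f g k :: "'a \<Rightarrow> complex"
  define B :: "'a \<Rightarrow> 'a \<Rightarrow> complex"
    where "B i j = (if i = j then 1 else 0) - 1 / of_nat CARD('a)" for i j
  show "(\<Sum>i\<in>UNIV. \<Sum>j\<in>UNIV. (f i + g i) * k j * ((if i = j then 1 else 0) - 1 / of_nat CARD('a))) =
      (\<Sum>i\<in>UNIV. \<Sum>j\<in>UNIV. f i * k j * ((if i = j then 1 else 0) - 1 / of_nat CARD('a))) +
      (\<Sum>i\<in>UNIV. \<Sum>j\<in>UNIV. g i * k j * ((if i = j then 1 else 0) - 1 / of_nat CARD('a)))"
    unfolding B_def[symmetric] by (simp only: distrib_right sum.distrib)
qed

lemma cartan_form_scale_left: "cartan_form (cartan_scale a x) z = a * cartan_form x z"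
  by transfer (simp only: sum_distrib_left mult.assoc)

lemma cartan_form_sym: "cartan_form x y = cartan_form y x"
proof transfer
  fix f g :: "'a \<Rightarrow> complex"
  show "(\<Sum>i\<in>UNIV. \<Sum>j\<in>UNIV. f i * g j * ((if i = j then 1 else 0) - 1 / of_nat CARD('a))) =
      (\<Sum>i\<in>UNIV. \<Sum>j\<in>UNIV. g i * f j * ((if i = j then 1 else 0) - 1 / of_nat CARD('a)))"
    by (subst sum.swap) (intro sum.cong refl, auto)
qed

lemma cartan_form_zero_left [simp]: "cartan_form 0 z = 0"
  using cartan_form_add_left[of 0 0 z] by simp

lemma cartan_form_sum_left: "cartan_form (\<Sum>i\<in>A. f i) z = (\<Sum>i\<in>A. cartan_form (f i) z)"
  by (induction A rule: infinite_finite_induct) (simp_all add: cartan_form_add_left)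

lemma cartan_form_gen:
  fixes i j :: "'n::finite"
  shows "cartan_form (cartan_gen i) (cartan_gen j) = (if i = j then 1 else 0) - 1 / of_nat CARD('n)"
proof transfer
  fix i j :: 'n
  define B :: "'n \<Rightarrow> 'n \<Rightarrow> complex"
    where "B k l = (if k = l then 1 else 0) - 1 / of_nat CARD('n)" for k l
  have "(\<Sum>l\<in>UNIV. (if k = i then 1 else 0) * (if l = j then 1 else 0) * B k l) =
      (if k = i then B k j else 0)" for k
    by (cases "k = i") (simp_all add: if_distrib[of "\<lambda>x. x * _"] cong: if_cong)
  then show "(\<Sum>k\<in>UNIV. \<Sum>l\<in>UNIV. (if k = i then 1 else 0) * (if l = j then 1 else 0) *
      ((if k = l then 1 else 0) - 1 / of_nat CARD('n) :: complex)) =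
      (if i = j then 1 else 0) - 1 / of_nat CARD('n)"
    unfolding B_def[symmetric] by simp
qed

lemma abs_cartan_eqI:
  fixes f g :: "'n \<Rightarrow> complex"
  assumes "\<And>i. f i = g i + t"
  shows "abs_cartan f = abs_cartan g"
  using assms by (auto simp: cartan.abs_eq_iff)

lemma sum_cartan_gen: "(\<Sum>i\<in>UNIV. cartan_gen i) = (0 :: ('n::finite) cartan)"
proof -
  have "(\<Sum>i\<in>A. cartan_gen i) = abs_cartan (\<lambda>k. if k \<in> A then 1 else 0)" if "finite A"
    for A :: "'n set"
    using that
  proof (induction A rule: finite_induct)
    case (insert i A)
    then show ?case
      by (simp add: cartan_gen.abs_eq plus_cartan.abs_eq)
        (rule arg_cong[where f = abs_cartan], auto simp: fun_eq_iff)
  qed (simp add: zero_cartan_def)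
  then have "(\<Sum>i\<in>UNIV. cartan_gen i) = abs_cartan (\<lambda>k::'n. 1)" by simp
  also have "\<dots> = abs_cartan (\<lambda>_. 0)" by (rule abs_cartan_eqI[where t = 1]) simp
  finally show ?thesis by (simp add: zero_cartan_def)
qed

text \<open>Carries linear identities of the Cartan space over to the generators of each degree. It
  is well defined because adding a constant function to a representative adds a multiple of a trace
  relation.\<close>

lift_definition cartan_to_Hplus :: "nat \<Rightarrow> 'n cartan \<Rightarrow> ('n::finite) Hplus"
  is "\<lambda>m f. fps_const (\<Sum>l\<in>UNIV. Poly_Mapping.single 0 (f l) * mvar (l, l, m))"
proof -
  fix m and f g :: "'n \<Rightarrow> complex"
  assume "\<exists>t. \<forall>i. f i = g i + t"
  then obtain t where t: "\<And>i. f i = g i + t" by blast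
  let ?T = "fps_const (\<Sum>l\<in>UNIV. mvar (l, l, m)) :: ('n \<times> 'n \<times> nat) mpoly fps"
  have "?T \<in> ideal_gen trace_rels"
    using ideal_gen_base[of ?T trace_rels 1 1] by (auto simp: trace_rels_def)
  then have "fps_const (Poly_Mapping.single 0 t) * ?T \<in> ideal_gen trace_rels"
    by (rule ideal_gen_mult_left)
  moreover have "fps_const (\<Sum>l\<in>UNIV. Poly_Mapping.single 0 (f l) * mvar (l, l, m)) -
      fps_const (\<Sum>l\<in>UNIV. Poly_Mapping.single 0 (g l) * mvar (l, l, m)) =
      fps_const (Poly_Mapping.single 0 t) * ?T"
    by (simp add: t single_add ring_distribs sum.distrib sum_distrib_left)
  ultimately show "fps_const (\<Sum>l\<in>UNIV. Poly_Mapping.single 0 (f l) * mvar (l, l, m)) -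
      fps_const (\<Sum>l\<in>UNIV. Poly_Mapping.single 0 (g l) * mvar (l, l, m)) \<in> h_ideal trace_rels"
    unfolding h_ideal_def by (auto intro!: exI[of _ 0])
qed

lemma cartan_to_Hplus_add: "cartan_to_Hplus m (x + y) = cartan_to_Hplus m x + cartan_to_Hplus m y"
  by transfer (simp add: single_add ring_distribs sum.distrib h_ideal_zero)

lemma cartan_to_Hplus_zero [simp]: "cartan_to_Hplus m 0 = 0"
  using cartan_to_Hplus_add[of m 0 0] by simp

lemma cartan_to_Hplus_scale:
  "cartan_to_Hplus m (cartan_scale z x) = Hscale (fps_const z) (cartan_to_Hplus m x)"
  by transfer (simp add: of_series_const sum_distrib_left mult_single h_ideal_zero flip: mult.assoc)

lemma cartan_to_Hplus_sum: "cartan_to_Hplus m (\<Sum>i\<in>A. f i) = (\<Sum>i\<in>A. cartan_to_Hplus m (f i))"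
  by (induction A rule: infinite_finite_induct) (simp_all add: cartan_to_Hplus_add)

lemma cartan_to_Hplus_gen: "cartan_to_Hplus m (cartan_gen i) = xgen i i (Suc m)"
proof transfer
  fix m :: nat and i :: 'a
  have "(\<Sum>l\<in>UNIV. Poly_Mapping.single 0 (if l = i then 1 else 0 :: complex) * mvar (l, l, m)) =
      (\<Sum>l\<in>UNIV. if l = i then mvar (l, l, m) else 0)"
    by (intro sum.cong) auto
  then show "fps_const (\<Sum>l\<in>UNIV. Poly_Mapping.single 0 (if l = i then 1 else 0) * mvar (l, l, m)) -
      fps_const (mvar (i, i, Suc m - 1)) \<in> h_ideal trace_rels"
    by (simp add: h_ideal_zero)
qed

lemma cartan_to_Hplus_hat: "cartan_to_Hplus m (cartan_hat \<nu> j) = x_hat \<nu> j (Suc m)"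
  by (simp add: cartan_hat_def x_hat_def cartan_to_Hplus_sum cartan_to_Hplus_scale
      cartan_to_Hplus_gen)

section \<open>Evaluation of polynomials at the new generators\<close>

definition hat_rep :: "('n \<Rightarrow> 'n \<Rightarrow> complex) \<Rightarrow> 'n \<times> nat \<Rightarrow> (('n::{finite,linorder}) \<times> 'n \<times> nat) mpoly" where
  "hat_rep \<nu> = (\<lambda>(j, m). \<Sum>i\<in>{..j}. Poly_Mapping.single 0 (\<nu> i j) * mvar (i, i, m))"

lemma hat_eval_conv: "hat_eval \<nu> f = abs_Hplus (subst_h (hat_rep \<nu>) f)"
  by (simp add: hat_eval.abs_eq subst_h_def hat_rep_def)

lemma hat_eval_add: "hat_eval \<nu> (f + g) = hat_eval \<nu> f + hat_eval \<nu> g"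
  by (simp add: hat_eval_conv subst_h_add plus_Hplus.abs_eq)

lemma hat_eval_mult: "hat_eval \<nu> (f * g) = hat_eval \<nu> f * hat_eval \<nu> g"
  by (simp add: hat_eval_conv subst_h_mult times_Hplus.abs_eq)

lemma hat_eval_scale: "hat_eval \<nu> (of_series a * f) = Hscale a (hat_eval \<nu> f)"
  by (simp add: hat_eval_conv subst_h_mult Hscale.abs_eq)

lemma hat_eval_of_series: "hat_eval \<nu> (of_series a) = Hscale a 1"
  by (simp add: hat_eval_conv one_Hplus_def Hscale.abs_eq)

lemma hat_eval_one: "hat_eval \<nu> 1 = 1"
  using hat_eval_of_series[of \<nu> 1] by (simp add: of_series_one)

lemma hat_eval_zero [simp]: "hat_eval \<nu> 0 = 0"
  using hat_eval_add[of \<nu> 0 0] by simp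

lemma hat_eval_sum: "hat_eval \<nu> (\<Sum>i\<in>A. f i) = (\<Sum>i\<in>A. hat_eval \<nu> (f i))"
  by (induction A rule: infinite_finite_induct) (simp_all add: hat_eval_add)

lemma abs_Hplus_sum: "abs_Hplus (\<Sum>i\<in>A. f i) = (\<Sum>i\<in>A. abs_Hplus (f i))"
  by (induction A rule: infinite_finite_induct)
    (simp_all add: zero_Hplus_def flip: plus_Hplus.abs_eq)

lemma fps_const_sum: "fps_const (\<Sum>i\<in>A. f i) = (\<Sum>i\<in>A. fps_const (f i :: 'a::comm_ring_1))"
  by (induction A rule: infinite_finite_induct) (simp_all flip: fps_const_add)

lemma hat_eval_mvar: "hat_eval \<nu> (fps_const (mvar (j, m))) = x_hat \<nu> j (Suc m)"
proof -
  have "hat_eval \<nu> (fps_const (mvar (j, m))) =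
      abs_Hplus (fps_const (\<Sum>i\<in>{..j}. Poly_Mapping.single 0 (\<nu> i j) * mvar (i, i, m)))"
    by (simp add: hat_eval_conv subst_h_const hat_rep_def)
  also have "\<dots> = (\<Sum>i\<in>{..j}. abs_Hplus (fps_const (Poly_Mapping.single 0 (\<nu> i j) * mvar (i, i, m))))"
    by (simp only: fps_const_sum abs_Hplus_sum)
  also have "\<dots> = x_hat \<nu> j (Suc m)"
    unfolding x_hat_def by (intro sum.cong refl) (simp add: xgen.abs_eq Hscale.abs_eq of_series_const)
  finally show ?thesis .
qed

lemma hat_eval_const_mult:
  "hat_eval \<nu> (fps_const (Poly_Mapping.single 0 z * p)) =
     Hscale (fps_const z) (hat_eval \<nu> (fps_const p))"
  unfolding hat_eval_scale[symmetric] of_series_const by simp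

lemma hat_eval_mvar_mult:
  "hat_eval \<nu> (fps_const (mvar (k, s) * p)) = x_hat \<nu> k (Suc s) * hat_eval \<nu> (fps_const p)"
  unfolding hat_eval_mvar[symmetric] hat_eval_mult[symmetric] by simp

lemma hat_eval_const_add:
  "hat_eval \<nu> (fps_const (p + q)) = hat_eval \<nu> (fps_const p) + hat_eval \<nu> (fps_const q)"
  unfolding hat_eval_add[symmetric] by simp

section \<open>The coordinate map that splits the evaluation\<close>

text \<open>The coefficients are the coordinates of \<open>cartan_gen i\<close> in the orthonormal
  basis. Off-diagonal variables go to 0; they do not occur in the trace relations, so the map
  descends to all of \<open>Hplus\<close>.\<close>

definition to_hat :: "('n \<Rightarrow> 'n \<Rightarrow> complex) \<Rightarrow> 'n \<times> 'n \<times> nat \<Rightarrow> (('n::{finite,linorder}) \<times> nat) mpoly" where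
  "to_hat \<nu> = (\<lambda>(i, l, m). if i = l then \<Sum>k\<in>low_indices.
     Poly_Mapping.single 0 (cartan_form (cartan_gen i) (cartan_hat \<nu> k)) * mvar (k, m) else 0)"

lemma single_sum: "Poly_Mapping.single m (\<Sum>i\<in>A. f i) = (\<Sum>i\<in>A. Poly_Mapping.single m (f i))"
  by (induction A rule: infinite_finite_induct) (simp_all add: single_add)

text \<open>Once the sums are interchanged, the coefficient of \<open>mvar (k, m)\<close> is the
  form applied to the sum of all \<open>cartan_gen i\<close>, which is zero.\<close>

lemma subst_to_hat_trace: "mpoly_subst (to_hat \<nu>) (\<Sum>i\<in>UNIV. mvar (i, i, m)) = 0"
proof -
  have "mpoly_subst (to_hat \<nu>) (\<Sum>i\<in>UNIV. mvar (i, i, m)) = (\<Sum>k\<in>low_indices.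
      Poly_Mapping.single 0 (\<Sum>i\<in>UNIV. cartan_form (cartan_gen i) (cartan_hat \<nu> k)) * mvar (k, m))"
    unfolding mpoly_subst_sum mpoly_subst_mvar single_sum sum_distrib_right
    by (simp only: to_hat_def prod.case simp_thms if_True) (rule sum.swap)
  also have "\<dots> = 0"
    unfolding cartan_form_sum_left[symmetric] sum_cartan_gen by simp
  finally show ?thesis .
qed

lemma subst_h_to_hat_h_ideal:
  assumes "f \<in> h_ideal trace_rels"
  shows "subst_h (to_hat \<nu>) f = 0"
proof (rule fps_ext)
  fix n
  \<comment> \<open>Approximation modulo \<open>h^(n+1)\<close> does not disturb the coefficient of
    \<open>h^n\<close>, which can therefore be computed from an element of the algebraic
    ideal.\<close>
  obtain g k where g: "g \<in> ideal_gen trace_rels" "f - g = fps_X ^ Suc n * k"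
    using assms unfolding h_ideal_def by blast
  have "fps_nth (f - g) n = 0"
    unfolding g(2) fps_X_power_mult_nth by simp
  moreover have "subst_h (to_hat \<nu>) g = 0"
    using g(1)
    by induction
      (auto simp: subst_h_add subst_h_mult trace_rels_def subst_h_const subst_to_hat_trace)
  then have "mpoly_subst (to_hat \<nu>) (fps_nth g n) = 0"
    by (simp add: fps_eq_iff)
  ultimately show "fps_nth (subst_h (to_hat \<nu>) f) n = fps_nth 0 n" by simp
qed

lift_definition hat_coords ::
  "('n \<Rightarrow> 'n \<Rightarrow> complex) \<Rightarrow> 'n Hplus \<Rightarrow> (('n::{finite,linorder}) \<times> nat) mpoly fps"
  is "\<lambda>\<nu>. subst_h (to_hat \<nu>)"
  using subst_h_to_hat_h_ideal subst_h_diff by (metis eq_iff_diff_eq_0)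

lemma hat_coords_add: "hat_coords \<nu> (v + w) = hat_coords \<nu> v + hat_coords \<nu> w"
  by transfer (rule subst_h_add)

lemma hat_coords_mult: "hat_coords \<nu> (v * w) = hat_coords \<nu> v * hat_coords \<nu> w"
  by transfer (rule subst_h_mult)

lemma hat_coords_one: "hat_coords \<nu> 1 = 1"
  by transfer (metis of_series_one subst_h_of_series)

lemma hat_coords_scale: "hat_coords \<nu> (Hscale a v) = of_series a * hat_coords \<nu> v"
  by transfer (simp add: subst_h_mult)

lemma hat_coords_xgen: "hat_coords \<nu> (xgen i i r) = fps_const (to_hat \<nu> (i, i, r - 1))"
  by transfer (simp add: subst_h_const)

lemma hat_polys_iff: "f \<in> hat_polys \<longleftrightarrow> (\<forall>n. fps_nth f n \<in> mpoly_vars_in (low_indices \<times> UNIV))"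
  by (simp add: hat_polys_def mpoly_vars_in_def)

lemma hat_coords_in_hat_polys: "hat_coords \<nu> v \<in> hat_polys"
proof transfer
  fix \<nu> :: "'a \<Rightarrow> 'a \<Rightarrow> complex" and f :: "('a \<times> 'a \<times> nat) mpoly fps"
  have "to_hat \<nu> x \<in> mpoly_vars_in (low_indices \<times> UNIV)" for x
    unfolding to_hat_def
    by (cases x) (auto intro!: mpoly_vars_in_sum mpoly_vars_in_mult mpoly_vars_in_mvar
        simp: mpoly_vars_in_const[of 0, simplified])
  then show "subst_h (to_hat \<nu>) f \<in> hat_polys"
    unfolding hat_polys_iff by (simp add: mpoly_subst_vars_in)
qed

text \<open>The vectors equal to their expansion form a subspace; by orthonormality it contains the
  basis, which spans.\<close>

lemma cartan_expansion:
  assumes "orthonormal_basis \<nu>"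
  shows "(\<Sum>k\<in>low_indices. cartan_scale (cartan_form x (cartan_hat \<nu> k)) (cartan_hat \<nu> k)) = x"
proof -
  let ?E = "\<lambda>x. \<Sum>k\<in>low_indices. cartan_scale (cartan_form x (cartan_hat \<nu> k)) (cartan_hat \<nu> k)"
  have "?E (x + y) = ?E x + ?E y" for x y
    by (simp only: cartan_form_add_left cartan.scale_left_distrib sum.distrib)
  moreover have "?E (cartan_scale a x) = cartan_scale a (?E x)" for a x
    by (simp only: cartan_form_scale_left cartan.scale_sum_right cartan.scale_scale)
  ultimately have "cartan.subspace {x. ?E x = x}"
    unfolding cartan.subspace_def by simp
  moreover have "?E (cartan_hat \<nu> j) = cartan_hat \<nu> j" if "j \<in> low_indices" for j
  proof -
    have "?E (cartan_hat \<nu> j) = (\<Sum>k\<in>low_indices. if j = k then cartan_hat \<nu> k else 0)"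
      using assms that by (intro sum.cong) (auto simp: orthonormal_basis_def)
    with that show ?thesis by simp
  qed
  ultimately have "cartan.span (cartan_hat \<nu> ` low_indices) \<subseteq> {x. ?E x = x}"
    by (intro cartan.span_minimal) auto
  with assms show ?thesis by (auto simp: orthonormal_basis_def)
qed

text \<open>This is the image of \<open>cartan_expansion\<close> for \<open>cartan_gen i\<close>
  under \<open>cartan_to_Hplus (r - 1)\<close>.\<close>

lemma hat_eval_coords_xgen:
  assumes "orthonormal_basis \<nu>" "r \<ge> 1"
  shows "hat_eval \<nu> (hat_coords \<nu> (xgen i i r)) = xgen i i r"
proof -
  have "hat_eval \<nu> (hat_coords \<nu> (xgen i i r)) =
      (\<Sum>k\<in>low_indices. Hscale (fps_const (cartan_form (cartan_gen i) (cartan_hat \<nu> k)))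
        (x_hat \<nu> k (Suc (r - 1))))"
    by (simp only: hat_coords_xgen to_hat_def prod.case simp_thms if_True fps_const_sum
        hat_eval_sum hat_eval_const_mult hat_eval_mvar)
  also have "\<dots> = cartan_to_Hplus (r - 1) (cartan_gen i)"
    by (subst cartan_expansion[OF assms(1), symmetric])
      (simp only: cartan_to_Hplus_sum cartan_to_Hplus_scale cartan_to_Hplus_hat)
  also have "\<dots> = xgen i i r"
    using assms(2) by (simp add: cartan_to_Hplus_gen)
  finally show ?thesis .
qed

lemma hat_eval_coords_VH_alg:
  assumes "orthonormal_basis \<nu>" "v \<in> VH_alg"
  shows "hat_eval \<nu> (hat_coords \<nu> v) = v"
  using assms(2)
  by induction
    (simp_all add: hat_coords_one hat_eval_one hat_eval_coords_xgen assms(1) hat_coords_add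
      hat_eval_add hat_coords_mult hat_eval_mult hat_coords_scale hat_eval_of_series
      Hscale_mult_left)

text \<open>Evaluation after coordinates is linear and fixes \<open>VH_alg\<close>, so its error on
  \<open>v\<close> is \<open>h^n\<close> times its error on the remainder \<open>u\<close>, for
  every \<open>n\<close>; separatedness concludes. Since \<open>u\<close> is only known to lie in
  \<open>Hplus\<close>, the coordinates have to be defined there.\<close>

lemma hat_eval_coords_VH:
  assumes "orthonormal_basis \<nu>" "v \<in> VH"
  shows "hat_eval \<nu> (hat_coords \<nu> v) = v"
proof -
  have "hat_eval \<nu> (hat_coords \<nu> v) - v \<in> hpow_sub Hscale UNIV n" for n
  proof -
    obtain w u where w: "w \<in> VH_alg" "v - w = Hscale (fps_X ^ n) u"
      using assms(2) unfolding VH_def hpow_sub_def by blast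
    have v: "v = w + Hscale (fps_X ^ n) u"
      using w(2) by (simp add: algebra_simps)
    have "hat_eval \<nu> (hat_coords \<nu> v) - v = Hscale (fps_X ^ n) (hat_eval \<nu> (hat_coords \<nu> u) - u)"
      by (simp add: v hat_coords_add hat_eval_add hat_eval_coords_VH_alg[OF assms(1) w(1)]
          hat_coords_scale hat_eval_scale Hplus.scale_right_diff_distrib)
    then show ?thesis by (auto simp: hpow_sub_def)
  qed
  then have "hat_eval \<nu> (hat_coords \<nu> v) - v = 0" by (rule Hplus_separated)
  then show ?thesis by simp
qed

text \<open>Guarantees that the preimage chosen by \<open>inv_into\<close> in
  \<open>x_hat_deriv\<close> evaluates back to the given vector.\<close>

lemma hat_eval_surj:
  assumes "orthonormal_basis \<nu>" "v \<in> VH"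
  shows "v \<in> hat_eval \<nu> ` hat_polys"
  using hat_eval_coords_VH[OF assms] hat_coords_in_hat_polys by (metis imageI)

section \<open>The leading term of the series S\<close>

text \<open>With \<open>z = h/u\<close> and \<open>w = -z + C z^2 - ...\<close> the trace condition
  is \<open>G (N (1 + z w) - (z + w)) = N\<close>, so \<open>G = 1 + (1 + C/N) z^2 + ...\<close>. At
  order \<open>z^2\<close> the identity part contributes \<open>C/N\<close> and the permutation part
  \<open>-C\<close> when \<open>i = j\<close>.\<close>

lemma poly_S_coeff_diag_0:
  fixes i j :: "'n::finite"
  shows "poly (S_coeff (i, i) (j, j) 0) c = - c * cartan_form (cartan_gen i) (cartan_gen j)"
proof -
  define N :: "complex poly fps" where "N = of_nat CARD('n)"
  define G where "G = G_series TYPE('n)"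
  define D where "D = N * (1 + fps_X * crossed_var) - (fps_X + crossed_var)"
  have "G * D = N"
    using theI'[OF ex1_G_series[where ?'n = 'n]]
    unfolding G_series_condition G_def G_series_def N_def D_def .
  then have *: "fps_nth (G * D) k = fps_nth N k" for k by simp
  have N: "N = fps_const [:of_nat CARD('n):]"
    by (simp add: N_def of_nat_fps_poly)
  have cross2: "fps_nth crossed_var 2 = [:0, 1:]"
    by (simp add: crossed_var_def numeral_2_eq_2)
  note cross = crossed_var_nth cross2 crossed_var_nth(2)[folded One_nat_def]
  have D: "fps_nth D 0 = [:of_nat CARD('n):]" "fps_nth D 1 = 0"
    "fps_nth D 2 = - [:of_nat CARD('n):] - [:0, 1:]"
    by (simp_all add: D_def N cross)
  have "smult (of_nat CARD('n)) (fps_nth G 0 - 1) = 0"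
    using *[of 0] by (simp add: D N smult_diff_right algebra_simps)
  then have G0: "fps_nth G 0 = 1" by simp
  have G1: "fps_nth G 1 = 0"
    using *[of 1] D by (simp add: fps_mult_nth N G0)
  have "fps_nth G 2 * fps_nth D 0 + fps_nth D 2 = 0"
    using *[of 2] D G0 G1 by (simp add: fps_mult_nth N numeral_2_eq_2 add.commute)
  then have "fps_nth G 2 * fps_nth D 0 = - fps_nth D 2"
    by (simp only: eq_neg_iff_add_eq_0)
  then have "fps_nth G 2 * [:of_nat CARD('n):] = [:of_nat CARD('n):] + [:0, 1:]"
    by (simp only: D) simp
  \<comment> \<open>Evaluation at \<open>c\<close> turns the equation into one between complex
    numbers, where \<open>N\<close> can be divided out.\<close>
  then have "poly (fps_nth G 2 * [:of_nat CARD('n):]) c = poly ([:of_nat CARD('n):] + [:0, 1:]) c"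
    by (rule arg_cong)
  then have G2: "poly (fps_nth G 2) c = 1 + c / of_nat CARD('n)"
    by (simp add: field_simps)
  have "fps_nth (G * (1 + fps_X * crossed_var) - 1) 2 = fps_nth G 2 - 1"
    using G0 G1 cross by (simp add: fps_mult_nth numeral_2_eq_2)
  moreover have "fps_nth (G * (fps_X + crossed_var)) 2 = [:0, 1:]"
    using G0 G1 cross by (simp add: fps_mult_nth numeral_2_eq_2)
  \<comment> \<open>The coefficient of \<open>e_ii \<otimes> e_jj\<close> has row and column
    \<open>(i, j)\<close>; the permutation term meets it when \<open>(i, j)\<close> equals its own
    swap.\<close>
  ultimately have "S_coeff (i, i) (j, j) 0 =
      fps_nth G 2 - 1 - (if i = j then [:0, 1:] else 0)"
    unfolding S_coeff_def GRR_def GRR_entry G_def[symmetric]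
    by (auto simp: numeral_2_eq_2)
  then have "poly (S_coeff (i, i) (j, j) 0) c =
      poly (fps_nth G 2 - 1 - (if i = j then [:0, 1:] else 0)) c"
    by (rule arg_cong)
  also have "\<dots> = - c * cartan_form (cartan_gen i) (cartan_gen j)"
    by (simp add: G2 cartan_form_gen algebra_simps)
  finally show ?thesis .
qed

section \<open>The scalars arising from commutators\<close>

text \<open>For \<open>a = (l, s)\<close> this is minus the commutator of \<open>y_i^(r)\<close>
  with multiplication by \<open>x_ll^(-s-1)\<close>, as \<open>act_y_xgen_mult\<close>
  shows.\<close>

definition contraction :: "complex \<Rightarrow> 'n \<Rightarrow> nat \<Rightarrow> ('n::finite) \<times> nat \<Rightarrow> complex fps" where
  "contraction c i r a =
     diff_coeff (S_at c (i, i) (fst a, fst a)) (- int r - 1) (int (snd a))"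

text \<open>At \<open>u^(-1) v^s\<close> the only candidate is the coefficient of \<open>S\<close>
  with index \<open>1 - s\<close>, while \<open>S\<close> starts at index 2.\<close>

lemma contraction_zero: "contraction c i 0 a = 0"
  by (auto simp: contraction_def diff_coeff_def S_at_def)

text \<open>The coefficient of \<open>S\<close> with index \<open>k = r + 1 - s\<close> carries
  \<open>h^(k-2)\<close>, so a constant term in \<open>h\<close> needs \<open>k = 2\<close>.\<close>

lemma contraction_nth_0:
  assumes "r \<ge> 1"
  shows "fps_nth (contraction c i r (l, s)) 0 =
    (if s = r - 1 then - (of_nat r * c * cartan_form (cartan_gen i) (cartan_gen l)) else 0)"
proof -
  have contr: "contraction c i r (l, s) = (if s < r
      then of_nat (r choose s) * (fps_X ^ (r - 1 - s) *
        fps_const (poly (S_coeff (i, i) (l, l) (r - 1 - s)) c)) else 0)"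
  proof (cases "s < r")
    case True
    then have "nat (- (- int r - 1 + int s)) = r + 1 - s" by simp
    with True show ?thesis
      by (auto simp: contraction_def diff_coeff_def S_at_def nat_add_distrib)
  qed (auto simp: contraction_def diff_coeff_def S_at_def)
  show ?thesis
  proof (cases "s = r - 1")
    case True
    \<comment> \<open>This binomial coefficient, from the expansion of \<open>(u - v)^(-2)\<close>,
      is the factor \<open>r\<close> of the theorem.\<close>
    then have "r choose s = r" using assms binomial_symmetric[of 1 r] by simp
    with True assms show ?thesis
      unfolding contr by (simp add: poly_S_coeff_diag_0)
  qed (auto simp: contr fps_X_power_nth)
qed

section \<open>The subalgebra and the operators on it\<close>

text \<open>A list is used because the formula for \<open>x^-(u)\<close> omits factors by position.
  An entry \<open>(l, s)\<close> records a power \<open>u^s\<close>, hence the generator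
  \<open>x_ll^(-s-1)\<close>.\<close>

definition diag_prod :: "('n \<times> nat) list \<Rightarrow> ('n::finite) Hplus" where
  "diag_prod xs = prod_list (map (\<lambda>(l, s). xgen l l (Suc s)) xs)"

lemma diag_prod_Nil [simp]: "diag_prod [] = 1"
  by (simp add: diag_prod_def)

lemma diag_prod_Cons [simp]: "diag_prod ((l, s) # xs) = xgen l l (Suc s) * diag_prod xs"
  by (simp add: diag_prod_def)

lemma diag_prod_append: "diag_prod (xs @ ys) = diag_prod xs * diag_prod ys"
  by (simp add: diag_prod_def)

lemma x_plus_prod_diag:
  "x_plus_prod (length xs) (map (\<lambda>a. (fst a, fst a)) xs) (map (\<lambda>a. int (snd a)) xs) = diag_prod xs"
proof -
  have "(\<Prod>k<length xs. xgen (fst (xs ! k)) (fst (xs ! k)) (Suc (snd (xs ! k)))) = diag_prod xs"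
    by (induction xs) (auto simp: prod.lessThan_Suc_shift simp del: prod.lessThan_Suc)
  then show ?thesis by (simp add: x_plus_prod_def)
qed

lemma delete_nth_map: "delete_nth k (map f xs) = map f (delete_nth k xs)"
  by (simp add: delete_nth_def take_map drop_map)

lemma delete_nth_Cons [simp]:
  "delete_nth 0 (x # xs) = xs" "delete_nth (Suc k) (x # xs) = x # delete_nth k xs"
  by (simp_all add: delete_nth_def)

lemma length_delete_nth: "k < length xs \<Longrightarrow> length (delete_nth k xs) = length xs - 1"
  by (simp add: delete_nth_def)

text \<open>Comparison of coefficients in the defining identity of \<open>x^-(u)\<close> at diagonal
  matrix units in all tensor factors, where \<open>S\<close> contributes the scalars
  \<open>s_il\<close>.\<close>

lemma x_minus_diag_prod:
  assumes "is_x_minus c xm"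
  shows "xm i i r (diag_prod xs) =
    - (\<Sum>k<length xs. Hscale (contraction c i r (xs ! k)) (diag_prod (delete_nth k xs)))"
\<comment> \<open>The defining identity covers \<open>n \<ge> 1\<close>; for the empty product the
  condition that \<open>x^-(u)\<close> kills the unit takes its place.\<close>
proof (cases xs)
  case Nil
  with assms show ?thesis by (simp add: is_x_minus_def)
next
  case Cons
  let ?ms = "map (\<lambda>a. (fst a, fst a)) xs" and ?ps = "map (\<lambda>a. int (snd a)) xs"
  let ?n = "length xs" and ?p = "- int r - 1"
  have omit: "S0_omit c ?n k ((i, i) # ?ms) (?p # ?ps) =
      Hscale (contraction c i r (xs ! k)) (diag_prod (delete_nth k xs))" if "k < ?n" for k
    using that x_plus_prod_diag[of "delete_nth k xs"]
    by (simp add: contraction_def delete_nth_map length_delete_nth)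
  have "apply0 (x_minus xm) (x_plus_prod ?n) =
      (\<lambda>ms ps. - (\<Sum>k<?n. S0_omit c ?n k ms ps))"
    using assms Cons by (simp add: is_x_minus_def)
  then have "apply0 (x_minus xm) (x_plus_prod ?n) ((i, i) # ?ms) (?p # ?ps) =
      - (\<Sum>k<?n. S0_omit c ?n k ((i, i) # ?ms) (?p # ?ps))"
    by (simp only:)
  then show ?thesis
    using omit by (simp add: x_minus_def x_plus_prod_diag)
qed

text \<open>At diagonal matrix units \<open>diag\<close> changes neither side of the identity
  defining the module, so its coefficients can be read off.\<close>

lemma act_y_diag_prod:
  assumes "is_VH_module c \<alpha> xm act"
  shows "act (HC_y i (- p - 1)) (diag_prod xs) =
    x_plus (i, i) p (diag_prod xs) + x_minus xm (i, i) p (diag_prod xs) +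
    a_series \<alpha> (i, i) p (diag_prod xs)"
proof -
  let ?ms = "map (\<lambda>a. (fst a, fst a)) xs" and ?ps = "map (\<lambda>a. int (snd a)) xs"
  let ?n = "length xs"
  have "apply0 (y_series act) (diag (x_plus_prod ?n)) ((i, i) # ?ms) (p # ?ps) =
      diag (apply0 (\<lambda>m p w. x_plus m p w + x_minus xm m p w + a_series \<alpha> m p w)
               (x_plus_prod ?n)) ((i, i) # ?ms) (p # ?ps)"
    using assms by (simp only: is_VH_module_def)
  then show ?thesis
    by (simp add: diag_def y_series_def x_plus_prod_diag)
qed

section \<open>The algebra of diagonal generators and its closure\<close>

lemma VH_alg_zero: "0 \<in> VH_alg"
  using VH_alg.intros(5)[OF VH_alg.intros(1), of 0] by simp

lemma subspace_VH_alg: "Hplus.subspace VH_alg"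
  by (auto simp: Hplus.subspace_def VH_alg_zero intro: VH_alg.intros)

lemma xgen_in_VH_alg: "xgen i i (Suc s) \<in> VH_alg"
  by (rule VH_alg.intros) simp

lemma diag_prod_in_VH_alg: "diag_prod xs \<in> VH_alg"
  by (induction xs) (auto intro: VH_alg.intros(1) VH_alg.intros(4)[OF xgen_in_VH_alg])

text \<open>Concatenation of lists multiplies the products, so their span is closed under
  multiplication.\<close>

lemma VH_alg_subset_span: "VH_alg \<subseteq> Hplus.span (range diag_prod)"
proof
  fix v :: "'a Hplus"
  assume "v \<in> VH_alg"
  then show "v \<in> Hplus.span (range diag_prod)"
  proof induction
    case 1
    show ?case by (rule Hplus.span_base) (metis diag_prod_Nil rangeI)
  next
    case (2 r i)
    have "diag_prod [(i, r - 1)] = xgen i i r" using 2 by simp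
    then show ?case by (metis Hplus.span_base rangeI)
  next
    case (4 v w)
    \<comment> \<open>Bilinearity is used one factor at a time: first the right factor varies
      against a fixed product, then the left one.\<close>
    have "diag_prod xs * w \<in> Hplus.span (range diag_prod)" for xs
      using 4(4)
    proof (induction rule: Hplus.span_induct_alt)
      case (step a x y)
      then obtain ys where "x = diag_prod ys" by blast
      then have "diag_prod xs * x \<in> Hplus.span (range diag_prod)"
        by (metis Hplus.span_base rangeI diag_prod_append)
      with step show ?case
        by (simp add: distrib_left Hscale_mult_right Hplus.span_add Hplus.span_scale)
    qed (simp add: Hplus.span_zero)
    note diag_prod_mult = this
    show ?case
      using 4(3)
      by (induction rule: Hplus.span_induct_alt)
        (auto simp: diag_prod_mult distrib_right Hscale_mult_left Hplus.span_add Hplus.span_scale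
          Hplus.span_zero)
  qed (auto intro: Hplus.span_add Hplus.span_scale)
qed

text \<open>Reduces identities between linear operators to products of generators, the vectors on
  which the module structure is prescribed.\<close>

lemma VH_alg_induct [consumes 1, case_names diag_prod add scale]:
  assumes "v \<in> VH_alg"
    and base: "\<And>xs. P (diag_prod xs)"
    and add: "\<And>v w. v \<in> VH_alg \<Longrightarrow> w \<in> VH_alg \<Longrightarrow> P v \<Longrightarrow> P w \<Longrightarrow> P (v + w)"
    and scale: "\<And>a v. v \<in> VH_alg \<Longrightarrow> P v \<Longrightarrow> P (Hscale a v)"
  shows "P v"
proof -
  have "P 0" using scale[OF diag_prod_in_VH_alg base, of 0] by simp
  have "v \<in> Hplus.span (range diag_prod)" using assms(1) VH_alg_subset_span by blast
  then have "v \<in> VH_alg \<and> P v"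
    by (induction rule: Hplus.span_induct_alt)
      (auto intro: add scale base VH_alg.intros diag_prod_in_VH_alg simp: VH_alg_zero \<open>P 0\<close>)
  then show ?thesis ..
qed

lemma VH_alg_subset_VH: "VH_alg \<subseteq> VH"
proof
  fix v :: "'a Hplus"
  assume "v \<in> VH_alg"
  moreover have "v - v \<in> hpow_sub Hscale UNIV n" for n
    unfolding hpow_sub_iff by (rule bexI[of _ 0]) auto
  ultimately show "v \<in> VH" unfolding VH_def by blast
qed

lemma VH_alg_mult_VH:
  assumes "v \<in> VH_alg" "w \<in> VH"
  shows "v * w \<in> VH"
  unfolding VH_def
proof (intro CollectI allI)
  fix n
  obtain w' u where w': "w' \<in> VH_alg" "w - w' = Hscale (fps_X ^ n) u"
    using assms(2) unfolding VH_def hpow_sub_def by blast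
  have "v * w - v * w' = Hscale (fps_X ^ n) (v * u)"
    by (simp add: w' Hscale_mult_right flip: right_diff_distrib)
  with w' assms(1) show "\<exists>w'\<in>VH_alg. v * w - w' \<in> hpow_sub Hscale UNIV n"
    by (auto simp: hpow_sub_def intro!: bexI[of _ "v * w'"] VH_alg.intros)
qed

lemma x_hat_in_VH_alg:
  assumes "r \<ge> 1"
  shows "x_hat \<nu> j r \<in> VH_alg"
  unfolding x_hat_def
  by (intro Hplus.subspace_sum[OF subspace_VH_alg] VH_alg.intros(5) VH_alg.intros(2) assms)

lemma hat_eval_const_in_VH_alg:
  assumes "p \<in> mpoly_vars_in (low_indices \<times> UNIV)"
  shows "hat_eval \<nu> (fps_const p) \<in> VH_alg"
  using assms
proof (induction rule: mpoly_induct)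
  case (const z)
  show ?case
    using hat_eval_of_series[of \<nu> "fps_const z"]
    by (simp add: of_series_const VH_alg.intros)
next
  case (add p q)
  then show ?case by (simp add: hat_eval_const_add VH_alg.intros)
next
  case (mvar v m z)
  then show ?case
    by (cases v) (simp add: hat_eval_mvar_mult VH_alg.intros x_hat_in_VH_alg)
qed

lemma fps_decompose: "f = fps_const (fps_nth f 0) + fps_X * fps_shift 1 f"
  for f :: "'a::comm_ring_1 fps"
  by (rule fps_ext) (simp add: fps_X_mult_nth)

lemma hat_eval_decompose:
  "hat_eval \<nu> f =
     hat_eval \<nu> (fps_const (fps_nth f 0)) + Hscale fps_X (hat_eval \<nu> (fps_shift 1 f))"
proof -
  have "fps_X * fps_shift 1 f = of_series fps_X * fps_shift 1 f"
    by (simp add: of_series_X_power[of 1, simplified])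
  with fps_decompose[of f] have "f = fps_const (fps_nth f 0) + of_series fps_X * fps_shift 1 f"
    by (simp only:)
  then have "hat_eval \<nu> f =
      hat_eval \<nu> (fps_const (fps_nth f 0) + of_series fps_X * fps_shift 1 f)"
    by (rule arg_cong)
  then show ?thesis by (simp only: hat_eval_add hat_eval_scale)
qed

lemma fps_shift_in_hat_polys: "f \<in> hat_polys \<Longrightarrow> fps_shift k f \<in> hat_polys"
  by (simp add: hat_polys_iff)

text \<open>Truncations of \<open>f\<close> in \<open>h\<close> evaluate into \<open>VH_alg\<close>
  and approximate the value; the induction splits off one power of \<open>h\<close> at a
  time.\<close>

lemma hat_eval_in_VH:
  assumes "f \<in> hat_polys"
  shows "hat_eval \<nu> f \<in> VH"
proof -
  have "\<exists>w\<in>VH_alg. hat_eval \<nu> f - w \<in> hpow_sub Hscale UNIV n" for n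
    using assms
  proof (induction n arbitrary: f)
    case 0
    show ?case by (rule bexI[OF _ VH_alg_zero]) (simp add: hpow_sub_iff)
  next
    case (Suc n)
    then obtain w u where w: "w \<in> VH_alg"
      "hat_eval \<nu> (fps_shift 1 f) - w = Hscale (fps_X ^ n) u"
      using fps_shift_in_hat_polys unfolding hpow_sub_def by blast
    let ?w = "hat_eval \<nu> (fps_const (fps_nth f 0)) + Hscale fps_X w"
    have "?w \<in> VH_alg"
      using Suc.prems w by (auto simp: hat_polys_iff hat_eval_const_in_VH_alg intro: VH_alg.intros)
    moreover have "hat_eval \<nu> f - ?w = Hscale fps_X (hat_eval \<nu> (fps_shift 1 f) - w)"
      by (subst hat_eval_decompose) (simp add: Hplus.scale_right_diff_distrib)
    then have "hat_eval \<nu> f - ?w = Hscale (fps_X ^ Suc n) u"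
      by (simp only: w(2) power_Suc Hplus.scale_scale)
    ultimately show ?case unfolding hpow_sub_def by blast
  qed
  then show ?thesis by (simp add: VH_def)
qed

text \<open>The closure defining \<open>VH\<close> only places the remainder in
  \<open>Hplus\<close>. Writing \<open>w\<close> as the value of a series gives a remainder in
  \<open>VH\<close>, as congruence modulo \<open>h\<close> on \<open>VH\<close> demands.\<close>

lemma VH_cases:
  fixes \<nu> :: "'n::{finite,linorder} \<Rightarrow> 'n \<Rightarrow> complex" and w :: "'n Hplus"
  assumes "orthonormal_basis \<nu>" "w \<in> VH"
  obtains w0 w' where "w0 \<in> VH_alg" "w' \<in> VH" "w = w0 + Hscale fps_X w'"
proof -
  obtain f where f: "f \<in> hat_polys" "w = hat_eval \<nu> f"
    using hat_eval_surj[OF assms] by blast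
  show ?thesis
  proof (rule that)
    show "hat_eval \<nu> (fps_const (fps_nth f 0)) \<in> VH_alg"
      using f by (auto simp: hat_polys_iff intro: hat_eval_const_in_VH_alg)
    show "hat_eval \<nu> (fps_shift 1 f) \<in> VH"
      using f by (intro hat_eval_in_VH fps_shift_in_hat_polys)
    show "w = hat_eval \<nu> (fps_const (fps_nth f 0)) + Hscale fps_X (hat_eval \<nu> (fps_shift 1 f))"
      unfolding f by (rule hat_eval_decompose)
  qed
qed

section \<open>Bilinear extension to the orthonormal basis\<close>

lemma cartan_form_h_const_nth:
  "fps_nth (cartan_form_h (fps_const x) g) n = cartan_form x (fps_nth g n)"
proof -
  have "fps_nth (cartan_form_h (fps_const x) g) n =
      (\<Sum>k\<le>n. if k = 0 then cartan_form x (fps_nth g n) else 0)"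
    unfolding cartan_form_h_def fps_nth_Abs_fps by (intro sum.cong) auto
  then show ?thesis by simp
qed

lemma cartan_form_h_hat:
  "cartan_form_h (fps_const (cartan_hat \<nu> j)) \<alpha> =
     (\<Sum>i\<in>{..j}. fps_const (\<nu> i j) * cartan_form_h (fps_const (cartan_gen i)) \<alpha>)"
  by (rule fps_ext)
    (simp add: fps_sum_nth cartan_form_h_const_nth cartan_hat_def cartan_form_sum_left
      cartan_form_scale_left)

lemma cartan_form_scale_right: "cartan_form z (cartan_scale a x) = a * cartan_form z x"
  by (simp only: cartan_form_sym[of z] cartan_form_scale_left)

lemma cartan_form_sum_right: "cartan_form z (\<Sum>i\<in>A. f i) = (\<Sum>i\<in>A. cartan_form z (f i))"
  by (simp only: cartan_form_sym[of z] cartan_form_sum_left)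

lemma subspace_hpow_sub:
  assumes "module smul" "module.subspace smul W"
  shows "module.subspace smul (hpow_sub smul W n)"
proof -
  interpret module smul by (rule assms)
  note W = assms(2)
  show ?thesis
  proof (intro subspaceI)
    show "0 \<in> hpow_sub smul W n"
      unfolding hpow_sub_iff by (rule bexI[OF _ subspace_0[OF W]]) simp
  next
    fix x y
    assume "x \<in> hpow_sub smul W n" "y \<in> hpow_sub smul W n"
    then show "x + y \<in> hpow_sub smul W n"
      unfolding hpow_sub_def
      by (auto simp flip: scale_right_distrib intro!: imageI subspace_add[OF W])
  next
    fix a x
    assume "x \<in> hpow_sub smul W n"
    then obtain w where "w \<in> W" "x = smul (fps_X ^ n) w" unfolding hpow_sub_def by blast
    then have "smul a w \<in> W" "smul a x = smul (fps_X ^ n) (smul a w)"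
      by (auto simp: mult.commute intro: subspace_scale[OF W])
    then show "smul a x \<in> hpow_sub smul W n" unfolding hpow_sub_def by blast
  qed
qed

definition hat_contraction ::
  "complex \<Rightarrow> ('n \<Rightarrow> 'n \<Rightarrow> complex) \<Rightarrow> 'n \<Rightarrow> nat \<Rightarrow> ('n::{finite,linorder}) \<times> nat \<Rightarrow> complex fps" where
  "hat_contraction c \<nu> j r a = (\<Sum>i\<in>{..j}. fps_const (\<nu> i j) *
     (\<Sum>l\<in>{..fst a}. fps_const (\<nu> l (fst a)) * contraction c i r (l, snd a)))"

text \<open>By \<open>contraction_nth_0\<close> the constant term is \<open>-(r c)\<close> times the
  form of \<open>cartan_hat \<nu> j\<close> and \<open>cartan_hat \<nu> k\<close> when
  \<open>s = r - 1\<close>, and orthonormality makes it a Kronecker delta.\<close>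

lemma hat_contraction_nth_0:
  assumes "orthonormal_basis \<nu>" "j \<in> low_indices" "k \<in> low_indices" "r \<ge> 1"
  shows "fps_nth (hat_contraction c \<nu> j r (k, s)) 0 =
    (if (k, s) = (j, r - 1) then - (of_nat r * c) else 0)"
proof (cases "s = r - 1")
  case True
  have inner: "fps_nth (\<Sum>l\<in>{..k}. fps_const (\<nu> l k) * contraction c i r (l, s)) 0 =
      - (of_nat r * c) * cartan_form (cartan_gen i) (cartan_hat \<nu> k)" for i
    unfolding cartan_hat_def cartan_form_sum_right cartan_form_scale_right
    using True
    by (simp add: fps_sum_nth contraction_nth_0[OF assms(4)] sum_distrib_left sum_negf mult_ac)
  have "fps_nth (hat_contraction c \<nu> j r (k, s)) 0 = (\<Sum>i\<in>{..j}. \<nu> i j *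
      fps_nth (\<Sum>l\<in>{..k}. fps_const (\<nu> l k) * contraction c i r (l, s)) 0)"
    by (simp add: hat_contraction_def fps_sum_nth)
  also have "\<dots> =
      - (of_nat r * c) * (\<Sum>i\<in>{..j}. \<nu> i j * cartan_form (cartan_gen i) (cartan_hat \<nu> k))"
    unfolding inner by (simp add: sum_distrib_left mult_ac)
  also have "(\<Sum>i\<in>{..j}. \<nu> i j * cartan_form (cartan_gen i) (cartan_hat \<nu> k)) =
      cartan_form (cartan_hat \<nu> j) (cartan_hat \<nu> k)"
    by (simp only: cartan_hat_def[of \<nu> j] cartan_form_sum_left cartan_form_scale_left)
  also have "cartan_form (cartan_hat \<nu> j) (cartan_hat \<nu> k) = (if j = k then 1 else 0)"
    using assms by (simp add: orthonormal_basis_def)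
  finally show ?thesis using True by auto
next
  case False
  then show ?thesis
    by (simp add: hat_contraction_def fps_sum_nth contraction_nth_0[OF assms(4)])
qed

section \<open>Coefficientwise differentiation\<close>

definition deriv_h :: "'v \<Rightarrow> 'v mpoly fps \<Rightarrow> 'v mpoly fps" where
  "deriv_h v f = Abs_fps (\<lambda>n. mpoly_deriv v (fps_nth f n))"

lemma deriv_h_nth [simp]: "fps_nth (deriv_h v f) n = mpoly_deriv v (fps_nth f n)"
  by (simp add: deriv_h_def)

lemma mpoly_deriv_vars_in: "p \<in> mpoly_vars_in V \<Longrightarrow> mpoly_deriv v p \<in> mpoly_vars_in V"
  unfolding mpoly_vars_in_def mem_Collect_eq by (intro ballI) (rule keys_mpoly_deriv)

lemma deriv_h_in_hat_polys: "f \<in> hat_polys \<Longrightarrow> deriv_h v f \<in> hat_polys"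
  by (simp add: hat_polys_iff mpoly_deriv_vars_in)

lemma x_hat_deriv_conv:
  "x_hat_deriv \<nu> j r w = hat_eval \<nu> (deriv_h (j, r - 1) (inv_into hat_polys (hat_eval \<nu>) w))"
  by (simp add: x_hat_deriv_def deriv_h_def)

section \<open>The action of the generators\<close>

context
  fixes c :: complex
    and \<alpha> :: "('n::{finite,linorder}) cartan fps"
    and \<nu> :: "'n \<Rightarrow> 'n \<Rightarrow> complex"
    and xm :: "'n \<Rightarrow> 'n \<Rightarrow> nat \<Rightarrow> 'n Hplus \<Rightarrow> 'n Hplus"
    and act :: "'n HC \<Rightarrow> 'n Hplus \<Rightarrow> 'n Hplus"
  assumes basis: "orthonormal_basis \<nu>"
    and x_minus: "is_x_minus c xm"
    and VH_module: "is_VH_module c \<alpha> xm act"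
begin

interpretation HC: HC_module Hscale VH act
  using VH_module by (simp add: is_VH_module_def)

section \<open>Linearity of the action and exact formulas on \<open>VH_alg\<close>\<close>

lemma VH_algD: "w \<in> VH_alg \<Longrightarrow> w \<in> VH"
  using VH_alg_subset_VH by blast

lemma act_sum_left: "w \<in> VH \<Longrightarrow> act (\<Sum>i\<in>A. f i) w = (\<Sum>i\<in>A. act (f i) w)"
proof -
  assume w: "w \<in> VH"
  have "act 0 w = 0" using HC.act_add_left[OF w, of 0 0] by simp
  then show ?thesis
    by (induction A rule: infinite_finite_induct) (simp_all add: HC.act_add_left w)
qed

lemma act_sum_right:
  "(\<And>i. i \<in> A \<Longrightarrow> v i \<in> VH) \<Longrightarrow> act f (\<Sum>i\<in>A. v i) = (\<Sum>i\<in>A. act f (v i))"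
proof -
  assume v: "\<And>i. i \<in> A \<Longrightarrow> v i \<in> VH"
  have 0: "0 \<in> (VH :: 'n Hplus set)" by (rule Hplus.subspace_0[OF HC.subspace])
  have "act f 0 = 0" using HC.act_add_right[OF 0 0, of f] by simp
  then show ?thesis
    using v
    by (induction A rule: infinite_finite_induct)
      (simp_all add: HC.act_add_right Hplus.subspace_sum[OF HC.subspace])
qed

lemma act_y_hat:
  "w \<in> VH \<Longrightarrow> act (y_hat \<nu> j r) w = (\<Sum>i\<in>{..j}. Hscale (fps_const (\<nu> i j)) (act (HC_y i r) w))"
  by (simp add: y_hat_def act_sum_left HC.act_scale_left)

lemma act_y_neg:
  assumes "w \<in> VH_alg" "r \<ge> 1"
  shows "act (HC_y i (- int r)) w = xgen i i r * w"
  using assms(1)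
proof (induction rule: VH_alg_induct)
  case (diag_prod xs)
  show ?case
    \<comment> \<open>The exponent \<open>int r - 1\<close> is nonnegative, so only multiplication
      by \<open>x^+(u)\<close> contributes.\<close>
    using act_y_diag_prod[OF VH_module, of i "int r - 1" xs] assms(2)
    by (simp add: x_plus_def x_minus_def a_series_def nat_diff_distrib)
next
  case (add v w)
  then show ?case by (simp add: HC.act_add_right VH_algD distrib_left)
next
  case (scale a v)
  then show ?case by (simp add: HC.act_scale_right VH_algD Hscale_mult_right)
qed

text \<open>The exponent \<open>- int r - 1\<close> is negative, which removes
  \<open>x^+(u)\<close>; the term with \<open>\<alpha>\<close> sits at exponent -1, that is, at
  \<open>r = 0\<close>.\<close>

lemma act_y_nonneg_diag_prod:
  "act (HC_y i (int r)) (diag_prod xs) = xm i i r (diag_prod xs) +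
     (if r = 0 then Hscale (cartan_form_h (fps_const (cartan_gen i)) \<alpha>) (diag_prod xs) else 0)"
  using act_y_diag_prod[OF VH_module, of i "- int r - 1" xs]
  by (auto simp: x_plus_def x_minus_def a_series_def)

lemma act_y_pos_one: "r \<ge> 1 \<Longrightarrow> act (HC_y i (int r)) 1 = 0"
  using act_y_nonneg_diag_prod[of i r "[]"] x_minus by (simp add: is_x_minus_def)

lemma act_y_zero:
  assumes "w \<in> VH_alg"
  shows "act (HC_y i 0) w = Hscale (cartan_form_h (fps_const (cartan_gen i)) \<alpha>) w"
  using assms
proof (induction rule: VH_alg_induct)
  case (diag_prod xs)
  show ?case
    using act_y_nonneg_diag_prod[of i 0 xs]
    by (simp add: x_minus_diag_prod[OF x_minus] contraction_zero)
next
  case (add v w)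
  then show ?case by (simp add: HC.act_add_right VH_algD Hplus.scale_right_distrib)
next
  case (scale a v)
  then show ?case by (simp add: HC.act_scale_right VH_algD mult.commute)
qed

lemma act_y_xgen_mult:
  assumes "w \<in> VH_alg"
  shows "act (HC_y i (int r)) (xgen l l (Suc s) * w) =
    xgen l l (Suc s) * act (HC_y i (int r)) w - Hscale (contraction c i r (l, s)) w"
  using assms
proof (induction rule: VH_alg_induct)
  case (diag_prod xs)
  \<comment> \<open>Deleting position 0 produces the contraction with the new factor; deleting any
    later position leaves that factor in front.\<close>
  have "xm i i r (diag_prod ((l, s) # xs)) =
      xgen l l (Suc s) * xm i i r (diag_prod xs) - Hscale (contraction c i r (l, s)) (diag_prod xs)"
    unfolding x_minus_diag_prod[OF x_minus]
    by (simp add: sum.lessThan_Suc_shift sum_distrib_left Hscale_mult_right del: sum.lessThan_Suc)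
  then show ?case
    using act_y_nonneg_diag_prod[of i r "(l, s) # xs"] act_y_nonneg_diag_prod[of i r xs]
    by (simp add: distrib_left Hscale_mult_right)
next
  case (add v w)
  have "xgen l l (Suc s) * u \<in> VH" if "u \<in> VH_alg" for u
    using that by (intro VH_algD VH_alg.intros(4) xgen_in_VH_alg)
  with add show ?case
    by (simp add: HC.act_add_right VH_algD distrib_left Hplus.scale_right_distrib)
next
  case (scale a v)
  have "xgen l l (Suc s) * v \<in> VH"
    using scale by (intro VH_algD VH_alg.intros(4) xgen_in_VH_alg)
  with scale show ?case
    by (simp add: HC.act_scale_right VH_algD Hscale_mult_right Hplus.scale_right_diff_distrib
        mult.commute[of a])
qed

lemma act_y_x_hat_mult:
  assumes "w \<in> VH_alg"
  shows "act (HC_y i (int r)) (x_hat \<nu> k (Suc s) * w) = x_hat \<nu> k (Suc s) * act (HC_y i (int r)) w -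
    Hscale (\<Sum>l\<in>{..k}. fps_const (\<nu> l k) * contraction c i r (l, s)) w"
proof -
  have in_VH: "xgen l l (Suc s) * w \<in> VH" for l
    using assms by (intro VH_algD VH_alg.intros(4) xgen_in_VH_alg)
  have "act (HC_y i (int r)) (x_hat \<nu> k (Suc s) * w) =
      (\<Sum>l\<in>{..k}. Hscale (fps_const (\<nu> l k)) (act (HC_y i (int r)) (xgen l l (Suc s) * w)))"
    unfolding x_hat_def sum_distrib_right Hscale_mult_left
    by (simp add: act_sum_right HC.act_scale_right in_VH Hplus.subspace_scale[OF HC.subspace])
  then show ?thesis
    by (simp add: act_y_xgen_mult[OF assms] Hplus.scale_right_diff_distrib sum_subtractf
        x_hat_def sum_distrib_right Hscale_mult_left Hplus.scale_sum_left)
qed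

lemma act_y_hat_x_hat_mult:
  assumes "w \<in> VH_alg"
  shows "act (y_hat \<nu> j (int r)) (x_hat \<nu> k (Suc s) * w) =
    x_hat \<nu> k (Suc s) * act (y_hat \<nu> j (int r)) w - Hscale (hat_contraction c \<nu> j r (k, s)) w"
proof -
  have "x_hat \<nu> k (Suc s) * w \<in> VH"
    using assms by (intro VH_algD VH_alg.intros(4) x_hat_in_VH_alg) simp_all
  then show ?thesis
    by (simp add: act_y_hat VH_algD assms act_y_x_hat_mult hat_contraction_def
        Hplus.scale_right_diff_distrib sum_subtractf sum_distrib_left Hscale_mult_right
        Hplus.scale_sum_left Hplus.scale_sum_right)
qed

section \<open>Reduction modulo \<open>h\<close>\<close>

abbreviation hVH :: "'n Hplus set" where "hVH \<equiv> hpow_sub Hscale VH 1"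

lemma subspace_hVH: "Hplus.subspace hVH"
  by (rule subspace_hpow_sub[OF module_Hscale HC.subspace])

lemma scale_X_in_hVH: "w \<in> VH \<Longrightarrow> Hscale fps_X w \<in> hVH"
  by (auto simp: hpow_sub_def)

lemma VH_alg_mult_hVH: "v \<in> VH_alg \<Longrightarrow> w \<in> hVH \<Longrightarrow> v * w \<in> hVH"
  by (auto simp: hpow_sub_iff Hscale_mult_right intro: VH_alg_mult_VH)

lemma scale_mod_h:
  assumes "w \<in> VH"
  shows "Hscale a w - Hscale (fps_const (fps_nth a 0)) w \<in> hVH"
proof -
  have "Hscale a w = Hscale (fps_const (fps_nth a 0) + fps_X * fps_shift 1 a) w"
    by (rule arg_cong[OF fps_decompose])
  then have "Hscale a w - Hscale (fps_const (fps_nth a 0)) w =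
      Hscale fps_X (Hscale (fps_shift 1 a) w)"
    by (simp only: Hplus.scale_left_distrib Hplus.scale_scale add_diff_cancel_left')
  moreover have "Hscale (fps_shift 1 a) w \<in> VH"
    using assms by (rule Hplus.subspace_scale[OF HC.subspace])
  ultimately show ?thesis by (simp only: scale_X_in_hVH)
qed

text \<open>The generator and \<open>r c\<close> times the derivative both kill constants and have
  the same commutators with the \<open>x_hat\<close> modulo \<open>h\<close>. The claim is about
  polynomials rather than their values, so it applies to whichever preimage is chosen.\<close>

lemma act_y_hat_mpoly:
  assumes "j \<in> low_indices" "r \<ge> 1" "p \<in> mpoly_vars_in (low_indices \<times> UNIV)"
  shows "act (y_hat \<nu> j (int r)) (hat_eval \<nu> (fps_const p)) -
    Hscale (fps_const (of_nat r * c)) (hat_eval \<nu> (fps_const (mpoly_deriv (j, r - 1) p))) \<in> hVH"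
  using assms(3)
proof (induction rule: mpoly_induct)
  case (const z)
  have 1: "1 \<in> (VH :: 'n Hplus set)" by (intro VH_algD VH_alg.intros(1))
  have "act (y_hat \<nu> j (int r)) (Hscale (fps_const z) 1) = 0"
    by (simp add: HC.act_scale_right 1 act_y_hat act_y_pos_one[OF assms(2)])
  then show ?case
    using hat_eval_of_series[of \<nu> "fps_const z"] Hplus.subspace_0[OF subspace_hVH]
    by (simp add: of_series_const)
next
  case (add p q)
  let ?E = "act (y_hat \<nu> j (int r))" and ?a = "fps_const (of_nat r * c)"
  let ?v = "\<lambda>p. hat_eval \<nu> (fps_const p)" and ?D = "mpoly_deriv (j, r - 1)"
  have "?v p \<in> VH" "?v q \<in> VH"
    using add by (simp_all add: VH_algD hat_eval_const_in_VH_alg)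
  then have "?E (?v (p + q)) - Hscale ?a (?v (?D (p + q))) =
      (?E (?v p) - Hscale ?a (?v (?D p))) + (?E (?v q) - Hscale ?a (?v (?D q)))"
    by (simp add: HC.act_add_right hat_eval_const_add mpoly_deriv_add Hplus.scale_right_distrib
        del: fps_const_add fps_const_mult)
  also have "\<dots> \<in> hVH"
    by (intro Hplus.subspace_add[OF subspace_hVH] add)
  finally show ?case .
next
  case (mvar v m z)
  obtain k s where v: "v = (k, s)" by (cases v)
  with mvar have k: "k \<in> low_indices" by simp
  let ?E = "act (y_hat \<nu> j (int r))" and ?x = "x_hat \<nu> k (Suc s)"
  let ?C = "hat_contraction c \<nu> j r (k, s)"
  let ?\<delta> = "if (k, s) = (j, r - 1) then of_nat r * c else 0"
  let ?m = "Poly_Mapping.single m z"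
  define e where "e = hat_eval \<nu> (fps_const ?m)"
  define d where "d = hat_eval \<nu> (fps_const (mpoly_deriv (j, r - 1) ?m))"
  have e: "e \<in> VH_alg"
    unfolding e_def
    by (rule hat_eval_const_in_VH_alg) (use mvar in \<open>auto simp: mpoly_vars_in_def\<close>)
  have IH: "?E e - Hscale (fps_const (of_nat r * c)) d \<in> hVH"
    using mvar by (simp add: e_def d_def)
  have 1: "hat_eval \<nu> (fps_const (mvar v * ?m)) = ?x * e"
    by (simp only: v hat_eval_mvar_mult e_def)
  have 2: "Hscale (fps_const (of_nat r * c))
      (hat_eval \<nu> (fps_const (mpoly_deriv (j, r - 1) (mvar v * ?m)))) =
      ?x * Hscale (fps_const (of_nat r * c)) d + Hscale (fps_const ?\<delta>) e"
    by (cases "(k, s) = (j, r - 1)")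
      (simp_all only: v mpoly_deriv_mvar_mult hat_eval_const_add hat_eval_mvar_mult e_def d_def
        Hplus.scale_right_distrib Hscale_mult_right if_True if_False simp_thms prod.inject add_0_right fps_const_0_eq_0
        hat_eval_zero Hplus.scale_zero_left Hplus.scale_zero_right)
  \<comment> \<open>Orthonormality enters here: the extra Leibniz term is minus the constant term in
    \<open>h\<close> of the contraction.\<close>
  have "fps_const ?\<delta> = - fps_const (fps_nth ?C 0)"
    by (simp add: hat_contraction_nth_0[OF basis assms(1) k assms(2)])
  then have 3: "Hscale (fps_const ?\<delta>) e = - Hscale (fps_const (fps_nth ?C 0)) e"
    by (simp only: Hplus.scale_minus_left)
  \<comment> \<open>The difference is a generator times the induction hypothesis, minus the part of
    the contraction divisible by \<open>h\<close>.\<close>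
  have "?E (hat_eval \<nu> (fps_const (mvar v * ?m))) - Hscale (fps_const (of_nat r * c))
      (hat_eval \<nu> (fps_const (mpoly_deriv (j, r - 1) (mvar v * ?m)))) =
      ?x * (?E e - Hscale (fps_const (of_nat r * c)) d) -
      (Hscale ?C e - Hscale (fps_const (fps_nth ?C 0)) e)"
    unfolding 2 unfolding 1 act_y_hat_x_hat_mult[OF e] 3 by (simp add: algebra_simps)
  also have "\<dots> \<in> hVH"
    by (rule Hplus.subspace_diff[OF subspace_hVH VH_alg_mult_hVH[OF x_hat_in_VH_alg IH]
        scale_mod_h[OF VH_algD[OF e]]]) simp
  finally show ?case .
qed

lemma act_y_hat_pos:
  assumes "j \<in> low_indices" "r \<ge> 1"
  shows "equal_mod_h Hscale VH (act (y_hat \<nu> j (int r)))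
    (\<lambda>w. Hscale (fps_const (of_nat r * c)) (x_hat_deriv \<nu> j r w))"
  unfolding equal_mod_h_def
proof
  fix w :: "'n Hplus"
  assume w: "w \<in> VH"
  let ?E = "act (y_hat \<nu> j (int r))" and ?a = "fps_const (of_nat r * c)"
  \<comment> \<open>This is the very series that \<open>x_hat_deriv\<close> differentiates.\<close>
  define f where "f = inv_into hat_polys (hat_eval \<nu>) w"
  have f: "f \<in> hat_polys" "hat_eval \<nu> f = w"
    unfolding f_def
    using inv_into_into[OF hat_eval_surj[OF basis w]] f_inv_into_f[OF hat_eval_surj[OF basis w]]
    by blast+
  let ?D = "deriv_h (j, r - 1)"
  let ?f = "fps_shift 1 f"
  have f': "?f \<in> hat_polys" by (rule fps_shift_in_hat_polys[OF f(1)])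
  have f0: "fps_nth f 0 \<in> mpoly_vars_in (low_indices \<times> UNIV)" using f by (simp add: hat_polys_iff)
  have "?E w = ?E (hat_eval \<nu> (fps_const (fps_nth f 0))) + Hscale fps_X (?E (hat_eval \<nu> ?f))"
    unfolding f(2)[symmetric]
    by (subst hat_eval_decompose)
      (simp add: HC.act_add_right HC.act_scale_right VH_algD hat_eval_const_in_VH_alg f0
        hat_eval_in_VH f' Hplus.subspace_scale[OF HC.subspace] del: One_nat_def)
  \<comment> \<open>Differentiation is coefficientwise in \<open>h\<close>, so the derivative splits
    along the same decomposition as \<open>w\<close>.\<close>
  moreover have "fps_shift 1 (?D f) = ?D ?f" by (rule fps_ext) simp
  then have "x_hat_deriv \<nu> j r w = hat_eval \<nu> (fps_const (mpoly_deriv (j, r - 1) (fps_nth f 0))) +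
      Hscale fps_X (hat_eval \<nu> (?D ?f))"
    using hat_eval_decompose[of \<nu> "?D f"]
    by (simp add: x_hat_deriv_conv flip: f_def)
  ultimately have "?E w - Hscale ?a (x_hat_deriv \<nu> j r w) =
      (?E (hat_eval \<nu> (fps_const (fps_nth f 0))) -
       Hscale ?a (hat_eval \<nu> (fps_const (mpoly_deriv (j, r - 1) (fps_nth f 0))))) +
      Hscale fps_X (?E (hat_eval \<nu> ?f) - Hscale ?a (hat_eval \<nu> (?D ?f)))"
    by (simp add: Hplus.scale_right_distrib Hplus.scale_right_diff_distrib mult.commute)
  also have "\<dots> \<in> hVH"
    by (rule Hplus.subspace_add[OF subspace_hVH act_y_hat_mpoly[OF assms f0] scale_X_in_hVH])
      (intro Hplus.subspace_diff[OF HC.subspace] HC.act_closed Hplus.subspace_scale[OF HC.subspace]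
        hat_eval_in_VH f' deriv_h_in_hat_polys)
  finally show "?E w - Hscale ?a (x_hat_deriv \<nu> j r w) \<in> hVH" .
qed

text \<open>The formula is exact on \<open>VH_alg\<close>; the rest of \<open>w\<close> contributes
  \<open>h\<close> times a vector of \<open>VH\<close>.\<close>

lemma act_y_hat_neg:
  assumes "r \<ge> 1"
  shows "equal_mod_h Hscale VH (act (y_hat \<nu> j (- int r))) (\<lambda>w. x_hat \<nu> j r * w)"
  unfolding equal_mod_h_def
proof
  fix w :: "'n Hplus"
  assume "w \<in> VH"
  then obtain w0 w' where w: "w0 \<in> VH_alg" "w' \<in> VH" "w = w0 + Hscale fps_X w'"
    by (rule VH_cases[OF basis])
  let ?E = "act (y_hat \<nu> j (- int r))"
  have "?E w0 = x_hat \<nu> j r * w0"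
    by (simp add: act_y_hat VH_algD w act_y_neg[OF _ assms] x_hat_def sum_distrib_right Hscale_mult_left)
  moreover have "?E w = ?E w0 + Hscale fps_X (?E w')"
    by (simp add: w HC.act_add_right HC.act_scale_right VH_algD Hplus.subspace_scale[OF HC.subspace])
  ultimately have "?E w - x_hat \<nu> j r * w = Hscale fps_X (?E w' - x_hat \<nu> j r * w')"
    by (simp add: w distrib_left Hscale_mult_right Hplus.scale_right_diff_distrib)
  also have "\<dots> \<in> hVH"
    by (intro scale_X_in_hVH Hplus.subspace_diff[OF HC.subspace] HC.act_closed w VH_alg_mult_VH
        x_hat_in_VH_alg assms)
  finally show "?E w - x_hat \<nu> j r * w \<in> hVH" .
qed

lemma act_y_hat_zero:
  assumes "w \<in> VH"
  shows "act (y_hat \<nu> j 0) w = Hscale (cartan_form_h (fps_const (cartan_hat \<nu> j)) \<alpha>) w"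
proof -
  let ?E = "act (y_hat \<nu> j 0)" and ?a = "cartan_form_h (fps_const (cartan_hat \<nu> j)) \<alpha>"
  \<comment> \<open>On \<open>VH_alg\<close> the two sides agree exactly, so the error on
    \<open>w\<close> is \<open>h\<close> times the error on the remainder \<open>w'\<close>, again
    in \<open>VH\<close>. Iteration makes it divisible by every power of \<open>h\<close>, hence
    zero.\<close>
  have "?E w - Hscale ?a w \<in> hpow_sub Hscale UNIV n" for n
    using assms
  proof (induction n arbitrary: w)
    case 0
    show ?case by (simp add: hpow_sub_iff)
  next
    case (Suc n)
    obtain w0 w' where w: "w0 \<in> VH_alg" "w' \<in> VH" "w = w0 + Hscale fps_X w'"
      using VH_cases[OF basis Suc.prems] .
    have "?E w0 = Hscale ?a w0"
      by (simp add: act_y_hat VH_algD w act_y_zero cartan_form_h_hat Hplus.scale_sum_left)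
    moreover have "?E w = ?E w0 + Hscale fps_X (?E w')"
      by (simp add: w HC.act_add_right HC.act_scale_right VH_algD
          Hplus.subspace_scale[OF HC.subspace])
    ultimately have "?E w - Hscale ?a w = Hscale fps_X (?E w' - Hscale ?a w')"
      by (simp add: w Hplus.scale_right_distrib Hplus.scale_right_diff_distrib mult.commute)
    moreover obtain u where "?E w' - Hscale ?a w' = Hscale (fps_X ^ n) u"
      using Suc.IH[OF w(2)] by (auto simp: hpow_sub_iff)
    ultimately have "?E w - Hscale ?a w = Hscale (fps_X ^ Suc n) u"
      by (simp only: power_Suc Hplus.scale_scale)
    then show ?case unfolding hpow_sub_iff by blast
  qed
  then have "?E w - Hscale ?a w = 0" by (rule Hplus_separated)
  then show ?thesis by simp
qed

end

theorem corollary3p2: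
  fixes c :: complex
    and \<alpha> :: "('n::{finite,linorder}) cartan fps"
    and \<nu> :: "'n \<Rightarrow> 'n \<Rightarrow> complex"
    and xm :: "'n \<Rightarrow> 'n \<Rightarrow> nat \<Rightarrow> 'n Hplus \<Rightarrow> 'n Hplus"
    and act :: "'n HC \<Rightarrow> 'n Hplus \<Rightarrow> 'n Hplus"
  assumes "CARD('n) \<ge> 2"
    and "orthonormal_basis \<nu>"
    and "is_x_minus c xm"
    and "is_VH_module c \<alpha> xm act"
  shows "\<forall>j\<in>low_indices. \<forall>r\<ge>1.
      equal_mod_h Hscale VH (act (y_hat \<nu> j (- int r))) (\<lambda>w. x_hat \<nu> j r * w) \<and>
      equal_mod_h Hscale VH (act (y_hat \<nu> j (int r)))
        (\<lambda>w. Hscale (fps_const (of_nat r * c)) (x_hat_deriv \<nu> j r w)) \<and>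
      (\<forall>w\<in>VH. act (y_hat \<nu> j 0) w =
         Hscale (cartan_form_h (fps_const (cartan_hat \<nu> j)) \<alpha>) w)"
  using act_y_hat_neg[OF assms(2-4)] act_y_hat_pos[OF assms(2-4)] act_y_hat_zero[OF assms(2-4)]
  by blast

end
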